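(* Let $\Omega\subseteq\mathbb{R}^N$ ($N\ge 2$) be a bounded domain, let $\mathcal{L}=\sum_{i,j=1}^N\partial_i(b_{ij}(x)\partial_j)$ be uniformly $X$-elliptic in $\Omega$ with respect to a family $X=\{X_1,\dots,X_m\}$ of vector fields, and assume the Sobolev-type embedding property (S). Let $a\in L^1(\Omega)$ with $a\ge0$ and let $f\in L^1(\Omega)$. Assume that there exist $Q\in(0,+\infty)$ and a function $0\le R\in L^{\frac{2N_X}{N_X+2}}(\Omega)$ such that $|f(x)|\le Q\,a(x)+R(x)$ for a.e. $x\in\Omega$. Suppose in addition that $R\in L^r(\Omega)$ for some $r>N_X/2$ and that there exists $\alpha>0$ such that $a(x)\ge\alpha$ for a.e. $x\in\Omega$. Then the unique weak solution $u\in\mathscr{H}_X(\Omega)$ of the problem $$-\mathcal{L}u+a(x)u=f(x)\ \text{ in }\Omega,\qquad u=0\ \text{ on }\partial\Omega$$ is bounded, i.e. $u\in L^\infty(\Omega)$.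
   Context: **Vector fields and operator.** $X=\{X_1,\dots,X_m\}$ is a family of vector fields $X_j=(c_{j1},\dots,c_{jN})$ on $\mathbb{R}^N$ with $c_{jk}$ locally Lipschitz continuous on $\mathbb{R}^N$; $X_j$ is identified with the operator $X_j=\sum_{k=1}^N c_{jk}\partial_k$, and $Xu=(X_1u,\dots,X_mu)$ is the $X$-gradient. The coefficients $b_{ij}=b_{ji}$ are measurable functions on $\mathbb{R}^N$, and $B(x)=(b_{ij}(x))$. The operator $\mathcal{L}$ is uniformly $X$-elliptic in $\Omega$ if there is a constant $\Lambda>0$ such that $$\frac1\Lambda\sum_{j=1}^m\langle X_j(x),\xi\rangle^2\le\sum_{i,j=1}^N b_{ij}(x)\xi_i\xi_j\le\Lambda\sum_{j=1}^m\langle X_j(x),\xi\rangle^2\qquad\text{for all }\xi\in\mathbb{R}^N,\ x\in\Omega,$$ where $\langle X_j(x),\xi\rangle=\sum_{k=1}^N c_{jk}(x)\xi_k$. **Function space.** $u\mapsto\|u\|_X:=\|Xu\|_{L^2(\Omega)}$ is a norm on $C^1_0(\Omega)$, and $\mathscr{H}_X(\Omega)$ is the Hilbert space obtained as the completion of $C^1_0(\Omega)$ with respect to this norm, with scalar product $\langle u,v\rangle_X=\int_\Omega Xu\cdot Xv$. **Assumption (S).** There exists a number $2^*_X=2^*_X(\Omega)>2$ such that the embedding $\mathscr{H}_X(\Omega)\hookrightarrow L^p(\Omega)$ is continuous for $p\in[1,2^*_X]$ and compact for every $p\in[1,2^*_X)$. Elements of $\mathscr{H}_X(\Omega)$ are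 accordingly regarded as functions on $\Omega$. Set $N_X:=\frac{2\cdot 2^*_X}{2^*_X-2}$, so that $2^*_X=\frac{2N_X}{N_X-2}$. **Bilinear form.** By $X$-ellipticity, $\left|\int_\Omega B(x)\nabla u\cdot\nabla v\right|\le\Lambda\|u\|_X\|v\|_X$ for $u,v\in C^1_0(\Omega)$, so $(u,v)\mapsto\int_\Omega B(x)\nabla u\cdot\nabla v$ extends continuously to $\mathscr{H}_X(\Omega)\times\mathscr{H}_X(\Omega)$; the same notation is used for the extension. **Weak solution.** $u\in\mathscr{H}_X(\Omega)$ is a weak solution of the problem if $a\,u\in L^1(\Omega)$ and $$\int_\Omega B(x)\nabla u\cdot\nabla v+\int_\Omega a(x)uv=\int_\Omega f(x)v\qquad\text{for all }v\in\mathscr{H}_X(\Omega)\cap L^\infty(\Omega).$$ Under the assumptions preceding "Suppose in addition" in the claim, a weak solution in $\mathscr{H}_X(\Omega)$ exists and is unique. *)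

theory Defs
  imports "HOL-Analysis.Analysis"
begin

definition domain :: "(real^'n) set \<Rightarrow> bool" where
  "domain \<Omega> \<longleftrightarrow> open \<Omega> \<and> connected \<Omega> \<and> \<Omega> \<noteq> {}"

definition locally_lipschitz :: "(real^'n \<Rightarrow> real) \<Rightarrow> bool" where
  "locally_lipschitz c \<longleftrightarrow> (\<forall>x. \<exists>e>0. \<exists>L. L-lipschitz_on (cball x e) c)"

text \<open>Elements are representatives, so equality of elements is equality almost everywhere. The
  functions are defined on the whole space, but only their values on \<open>\<Omega>\<close> matter.\<close>

definition Lp :: "(real^'n) set \<Rightarrow> real \<Rightarrow> (real^'n \<Rightarrow> real) set" where
  "Lp \<Omega> p = {u \<in> borel_measurable (lebesgue_on \<Omega>).
     integrable (lebesgue_on \<Omega>) (\<lambda>x. \<bar>u x\<bar> powr p)}"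

definition Lp_norm :: "(real^'n) set \<Rightarrow> real \<Rightarrow> (real^'n \<Rightarrow> real) \<Rightarrow> real" where
  "Lp_norm \<Omega> p u = (\<integral>x. \<bar>u x\<bar> powr p \<partial>lebesgue_on \<Omega>) powr (1 / p)"

definition Linf :: "(real^'n) set \<Rightarrow> (real^'n \<Rightarrow> real) set" where
  "Linf \<Omega> = {u \<in> borel_measurable (lebesgue_on \<Omega>).
     \<exists>C. AE x in lebesgue_on \<Omega>. \<bar>u x\<bar> \<le> C}"

definition grad :: "(real^'n \<Rightarrow> real) \<Rightarrow> real^'n \<Rightarrow> real^'n" where
  "grad u x = (\<chi> i. frechet_derivative u (at x) (axis i 1))"

text \<open>A family of vector fields is \<open>X :: 'm \<Rightarrow> real^'n \<Rightarrow> real^'n\<close>, where \<open>X j x $ k\<close> is the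
  coefficient $c_{jk}(x)$; hence \<open>X j x \<bullet> grad u x\<close> is $(X_j u)(x)$.\<close>

definition X_gradient ::
  "('m::finite \<Rightarrow> real^'n \<Rightarrow> real^'n) \<Rightarrow> (real^'n \<Rightarrow> real) \<Rightarrow> real^'n \<Rightarrow> real^'m" where
  "X_gradient X u x = (\<chi> j. X j x \<bullet> grad u x)"

definition uniformly_X_elliptic ::
  "(real^'n) set \<Rightarrow> ('m::finite \<Rightarrow> real^'n \<Rightarrow> real^'n) \<Rightarrow> (real^'n \<Rightarrow> real^'n^'n) \<Rightarrow> bool" where
  "uniformly_X_elliptic \<Omega> X B \<longleftrightarrow>
     (\<exists>\<Lambda>>0. \<forall>x\<in>\<Omega>. \<forall>\<xi>.
        1 / \<Lambda> * (\<Sum>j\<in>UNIV. (X j x \<bullet> \<xi>)\<^sup>2) \<le> (\<Sum>i\<in>UNIV. \<Sum>j\<in>UNIV. B x $ i $ j * \<xi> $ i * \<xi> $ j) \<and>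
        (\<Sum>i\<in>UNIV. \<Sum>j\<in>UNIV. B x $ i $ j * \<xi> $ i * \<xi> $ j) \<le> \<Lambda> * (\<Sum>j\<in>UNIV. (X j x \<bullet> \<xi>)\<^sup>2))"

text \<open>Continuously differentiable functions with compact support in \<open>\<Omega>\<close>, extended by zero.\<close>

definition C1_0 :: "(real^'n) set \<Rightarrow> (real^'n \<Rightarrow> real) set" where
  "C1_0 \<Omega> = {u. (\<forall>x. u differentiable (at x)) \<and> continuous_on UNIV (grad u) \<and>
     (\<exists>K. compact K \<and> K \<subseteq> \<Omega> \<and> (\<forall>x. x \<notin> K \<longrightarrow> u x = 0))}"

definition X_norm ::
  "(real^'n) set \<Rightarrow> ('m::finite \<Rightarrow> real^'n \<Rightarrow> real^'n) \<Rightarrow> (real^'n \<Rightarrow> real) \<Rightarrow> real" where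
  "X_norm \<Omega> X u = sqrt (\<integral>x. (norm (X_gradient X u x))\<^sup>2 \<partial>lebesgue_on \<Omega>)"

text \<open>The completion of \<open>C1_0 \<Omega>\<close> with respect to \<open>X_norm \<Omega> X\<close> is realised in the standard way:
  its elements are the classes of Cauchy sequences modulo null sequences.\<close>

definition X_Cauchy ::
  "(real^'n) set \<Rightarrow> ('m::finite \<Rightarrow> real^'n \<Rightarrow> real^'n) \<Rightarrow> (nat \<Rightarrow> real^'n \<Rightarrow> real) set" where
  "X_Cauchy \<Omega> X = {\<phi>. (\<forall>n. \<phi> n \<in> C1_0 \<Omega>) \<and>
     (\<forall>e>0. \<exists>M. \<forall>m\<ge>M. \<forall>n\<ge>M. X_norm \<Omega> X (\<lambda>x. \<phi> m x - \<phi> n x) < e)}"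

definition X_equiv ::
  "(real^'n) set \<Rightarrow> ('m::finite \<Rightarrow> real^'n \<Rightarrow> real^'n) \<Rightarrow>
     ((nat \<Rightarrow> real^'n \<Rightarrow> real) \<times> (nat \<Rightarrow> real^'n \<Rightarrow> real)) set" where
  "X_equiv \<Omega> X = {(\<phi>, \<psi>). \<phi> \<in> X_Cauchy \<Omega> X \<and> \<psi> \<in> X_Cauchy \<Omega> X \<and>
     (\<lambda>n. X_norm \<Omega> X (\<lambda>x. \<phi> n x - \<psi> n x)) \<longlonglongrightarrow> 0}"

definition HX ::
  "(real^'n) set \<Rightarrow> ('m::finite \<Rightarrow> real^'n \<Rightarrow> real^'n) \<Rightarrow> (nat \<Rightarrow> real^'n \<Rightarrow> real) set set" where
  "HX \<Omega> X = X_Cauchy \<Omega> X // X_equiv \<Omega> X"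

definition HX_norm ::
  "(real^'n) set \<Rightarrow> ('m::finite \<Rightarrow> real^'n \<Rightarrow> real^'n) \<Rightarrow> (nat \<Rightarrow> real^'n \<Rightarrow> real) set \<Rightarrow> real" where
  "HX_norm \<Omega> X U = (THE l. \<forall>\<phi>\<in>U. (\<lambda>n. X_norm \<Omega> X (\<phi> n)) \<longlonglongrightarrow> l)"

text \<open>The continuous extension of $(u,v) \mapsto \int_\Omega B\nabla u\cdot\nabla v$ to the completion.\<close>

definition HX_form ::
  "(real^'n) set \<Rightarrow> (real^'n \<Rightarrow> real^'n^'n) \<Rightarrow> (nat \<Rightarrow> real^'n \<Rightarrow> real) set \<Rightarrow>
     (nat \<Rightarrow> real^'n \<Rightarrow> real) set \<Rightarrow> real" where
  "HX_form \<Omega> B U V = (THE l. \<forall>\<phi>\<in>U. \<forall>\<psi>\<in>V.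
     (\<lambda>n. \<integral>x. (B x *v grad (\<phi> n) x) \<bullet> grad (\<psi> n) x \<partial>lebesgue_on \<Omega>) \<longlonglongrightarrow> l)"

text \<open>The graph of the canonical map into $L^p(\Omega)$, i.e. of the continuous extension of the
  inclusion of \<open>C1_0 \<Omega>\<close>: \<open>u\<close> is the function that the element \<open>U\<close> of the completion stands for.\<close>

definition HX_fun ::
  "(real^'n) set \<Rightarrow> real \<Rightarrow> (nat \<Rightarrow> real^'n \<Rightarrow> real) set \<Rightarrow> (real^'n \<Rightarrow> real) \<Rightarrow> bool" where
  "HX_fun \<Omega> p U u \<longleftrightarrow>
     u \<in> Lp \<Omega> p \<and> (\<forall>\<phi>\<in>U. (\<lambda>n. Lp_norm \<Omega> p (\<lambda>x. \<phi> n x - u x)) \<longlonglongrightarrow> 0)"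

text \<open>The canonical map is everywhere defined, bounded and injective.\<close>

definition continuous_embedding ::
  "(real^'n) set \<Rightarrow> ('m::finite \<Rightarrow> real^'n \<Rightarrow> real^'n) \<Rightarrow> real \<Rightarrow> bool" where
  "continuous_embedding \<Omega> X p \<longleftrightarrow>
     (\<forall>U\<in>HX \<Omega> X. \<exists>u. HX_fun \<Omega> p U u) \<and>
     (\<exists>C. \<forall>U\<in>HX \<Omega> X. \<forall>u. HX_fun \<Omega> p U u \<longrightarrow> Lp_norm \<Omega> p u \<le> C * HX_norm \<Omega> X U) \<and>
     (\<forall>U\<in>HX \<Omega> X. \<forall>V\<in>HX \<Omega> X. \<forall>u. HX_fun \<Omega> p U u \<and> HX_fun \<Omega> p V u \<longrightarrow> U = V)"

definition compact_embedding ::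
  "(real^'n) set \<Rightarrow> ('m::finite \<Rightarrow> real^'n \<Rightarrow> real^'n) \<Rightarrow> real \<Rightarrow> bool" where
  "compact_embedding \<Omega> X p \<longleftrightarrow> continuous_embedding \<Omega> X p \<and>
     (\<forall>U u. (\<forall>k::nat. U k \<in> HX \<Omega> X \<and> HX_fun \<Omega> p (U k) (u k)) \<and> (\<exists>M. \<forall>k. HX_norm \<Omega> X (U k) \<le> M) \<longrightarrow>
        (\<exists>\<rho>::nat \<Rightarrow> nat. \<exists>w\<in>Lp \<Omega> p. strict_mono \<rho> \<and>
           (\<lambda>k. Lp_norm \<Omega> p (\<lambda>x. u (\<rho> k) x - w x)) \<longlonglongrightarrow> 0))"

text \<open>The Sobolev-type embedding assumption, with \<open>s\<close> in the role of the exponent $2^*_X$.\<close>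

definition sobolev_property ::
  "(real^'n) set \<Rightarrow> ('m::finite \<Rightarrow> real^'n \<Rightarrow> real^'n) \<Rightarrow> real \<Rightarrow> bool" where
  "sobolev_property \<Omega> X s \<longleftrightarrow> s > 2 \<and>
     (\<forall>p\<in>{1..s}. continuous_embedding \<Omega> X p) \<and> (\<forall>p\<in>{1..<s}. compact_embedding \<Omega> X p)"

definition N_X :: "real \<Rightarrow> real" where
  "N_X s = 2 * s / (s - 2)"

text \<open>The function associated with an element of the completion is its limit in $L^1(\Omega)$. As
  \<open>\<Omega>\<close> is bounded, this is also the limit in every $L^p(\Omega)$ into which the space embeds.\<close>

definition weak_solution ::
  "(real^'n) set \<Rightarrow> ('m::finite \<Rightarrow> real^'n \<Rightarrow> real^'n) \<Rightarrow> (real^'n \<Rightarrow> real^'n^'n) \<Rightarrow>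
     (real^'n \<Rightarrow> real) \<Rightarrow> (real^'n \<Rightarrow> real) \<Rightarrow> (real^'n \<Rightarrow> real) \<Rightarrow> bool" where
  "weak_solution \<Omega> X B a f u \<longleftrightarrow>
     (\<exists>U\<in>HX \<Omega> X. HX_fun \<Omega> 1 U u \<and>
        integrable (lebesgue_on \<Omega>) (\<lambda>x. a x * u x) \<and>
        (\<forall>V\<in>HX \<Omega> X. \<forall>v. HX_fun \<Omega> 1 V v \<and> v \<in> Linf \<Omega> \<longrightarrow>
           HX_form \<Omega> B U V + (\<integral>x. a x * u x * v x \<partial>lebesgue_on \<Omega>)
             = (\<integral>x. f x * v x \<partial>lebesgue_on \<Omega>)))"

end

theory Submission
  imports Defs
begin

text \<open>
  The proof is the level-set method of Stampacchia. Let \<open>A(k)\<close> be the set where \<open>|u| > k\<close>. For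
  \<open>k \<ge> Q\<close> and \<open>h > k\<close> the equation is tested with \<open>v = T(u)\<close>, where \<open>T\<close> is an odd truncation that
  vanishes on \<open>[-k, k]\<close> and is constant, of size \<open>d = (h - k) / 2\<close>, outside \<open>(-h, h)\<close>. Where \<open>v\<close> does
  not vanish, \<open>|u| \<ge> Q\<close>, and therefore the absorption term \<open>a u v = a |u| |v|\<close> dominates \<open>Q a |v|\<close>. This
  is the interplay between \<open>a\<close> and \<open>f\<close> on which everything rests: the merely integrable
  part of \<open>f\<close> disappears, and
  \[ \frac1\Lambda \|v\|_X^2 \le \int B\nabla u\cdot\nabla v \le \int R\,|v| \le d \int_{A(k)} R . \]
  The Sobolev embedding bounds \<open>d |A(h)|\<^bsup>1/s\<^esup>\<close> by a multiple of the norm of \<open>v\<close>, and the right-hand side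
  is at most a constant times \<open>d |A(k)|\<^bsup>1 - 1/r\<^esup>\<close>. Hence
  \[ |A(h)| \le \frac{M}{(h-k)^{s/2}}\, |A(k)|^{(1-1/r)s/2} \]
  (lemma \<open>level_set_decay\<close>). The condition \<open>r > N_X / 2 = s / (s - 2)\<close> says exactly that the last exponent
  exceeds 1, and then \<open>Stampacchia_iteration\<close> yields a level \<open>k\<close> with \<open>|A(k)| = 0\<close>.

  The remaining work is to show that \<open>v\<close> is an admissible test function and that the first inequality
  above holds, although the elements of the completion are classes of Cauchy sequences and have no
  gradient of their own. Both are settled at the level of representatives. The truncation is chosen
  of class \<open>C\<^sup>1\<close> with a Lipschitz derivative (\<open>smooth_truncation_exists\<close>), so for a sequence \<open>\<phi>\<close> that
  represents \<open>u\<close> the functions \<open>T(\<phi> n)\<close> are again test functions with \<open>X\<close>-gradient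
  \<open>T'(\<phi> n) X(\<phi> n)\<close>. They form a Cauchy sequence (\<open>X_Cauchy_compose\<close>), they converge to \<open>T(u)\<close>, and
  \<open>B\<nabla>\<phi>\<cdot>\<nabla>T(\<phi>) = T'(\<phi>) B\<nabla>\<phi>\<cdot>\<nabla>\<phi>\<close> is bounded below by \<open>|X T(\<phi>)|\<^sup>2 / \<Lambda>\<close> because \<open>0 \<le> T' \<le> 1\<close>
  (\<open>energy_truncation_lower\<close>). In the limit this gives \<open>truncation_test_function\<close>.
\<close>

section \<open>Elementary inequalities\<close>

text \<open>The infimum over \<open>t\<close> of the arithmetic means on the right is the geometric mean, attained at
  \<open>t = sqrt C / sqrt A\<close> when both numbers are positive. This turns every weighted Young inequality
  below into an inequality of Cauchy-Schwarz type.\<close>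

lemma geometric_mean_bound:
  fixes F A C :: real
  assumes A: "A \<ge> 0" and C: "C \<ge> 0" and F: "\<And>t. t > 0 \<Longrightarrow> F \<le> (t * A + C / t) / 2"
  shows "F \<le> sqrt A * sqrt C"
proof (cases "A = 0 \<or> C = 0")
  case False
  then have pos: "A > 0" "C > 0" using A C by auto
  have "F \<le> (sqrt C / sqrt A * A + C / (sqrt C / sqrt A)) / 2"
    using pos by (intro F) auto
  also have "sqrt C / sqrt A * A = sqrt A * sqrt C"
    using pos by (metis mult.commute real_div_sqrt less_imp_le times_divide_eq_left times_divide_eq_right)
  also have "C / (sqrt C / sqrt A) = sqrt A * sqrt C"
    using pos by (metis divide_divide_eq_right mult.commute real_div_sqrt less_imp_le times_divide_eq_left)
  finally show ?thesis by simp
next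
  case True
  have "F \<le> e" if "e > 0" for e
  proof (cases "A = 0")
    case True
    have "C / ((C + 1) / e) / 2 \<le> e"
      using C that by (simp add: field_simps add_increasing)
    moreover have "F \<le> C / ((C + 1) / e) / 2"
      using F[of "(C + 1) / e"] C that True by simp
    ultimately show ?thesis by (rule order_trans[rotated])
  next
    case False
    with \<open>A = 0 \<or> C = 0\<close> have "C = 0" by simp
    have "e / (A + 1) * A / 2 \<le> e" using A that by (simp add: field_simps add_increasing)
    moreover have "F \<le> e / (A + 1) * A / 2"
      using F[of "e / (A + 1)"] A that \<open>C = 0\<close> by simp
    ultimately show ?thesis by (rule order_trans[rotated])
  qed
  then have "F \<le> 0" by (rule field_le_epsilon) simp
  with True show ?thesis by auto
qed

lemma quadratic_form_eq:
  fixes B :: "real^'n^'n"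
  shows "(B *v \<xi>) \<bullet> \<xi> = (\<Sum>i\<in>UNIV. \<Sum>j\<in>UNIV. B $ i $ j * \<xi> $ i * \<xi> $ j)"
  by (subst inner_vec_def) (simp add: matrix_vector_mult_def sum_distrib_left sum_distrib_right mult_ac)

lemma symmetric_form_commute:
  fixes B :: "real^'n^'n"
  assumes "\<And>i j. B $ i $ j = B $ j $ i"
  shows "(B *v \<xi>) \<bullet> \<eta> = (B *v \<eta>) \<bullet> \<xi>"
proof -
  have "transpose B = B" using assms by (simp add: transpose_def vec_eq_iff)
  then show ?thesis by (metis dot_lmul_matrix inner_commute transpose_matrix_vector)
qed

text \<open>Semidefiniteness is applied to \<open>t \<xi> - \<eta>\<close> and optimised in \<open>t\<close>; this covers vectors in the
  kernel of the form together with all others.\<close>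

lemma semidefinite_form_Cauchy_Schwarz:
  fixes B :: "real^'n^'n"
  assumes sym: "\<And>i j. B $ i $ j = B $ j $ i" and pos: "\<And>\<xi>. 0 \<le> (B *v \<xi>) \<bullet> \<xi>"
  shows "\<bar>(B *v \<xi>) \<bullet> \<eta>\<bar> \<le> sqrt ((B *v \<xi>) \<bullet> \<xi>) * sqrt ((B *v \<eta>) \<bullet> \<eta>)"
proof -
  have "(B *v \<xi>) \<bullet> \<eta> \<le> sqrt ((B *v \<xi>) \<bullet> \<xi>) * sqrt ((B *v \<eta>) \<bullet> \<eta>)" for \<xi> \<eta>
  proof (rule geometric_mean_bound[OF pos pos])
    fix t :: real assume t: "t > 0"
    have "0 \<le> (B *v (t *\<^sub>R \<xi> - \<eta>)) \<bullet> (t *\<^sub>R \<xi> - \<eta>) / t"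
      using pos t by simp
    also have "\<dots> = t * ((B *v \<xi>) \<bullet> \<xi>) + ((B *v \<eta>) \<bullet> \<eta>) / t - 2 * ((B *v \<xi>) \<bullet> \<eta>)"
      using t symmetric_form_commute[of B \<eta> \<xi>, OF sym]
      by (simp add: matrix_vector_mult_diff_distrib matrix_vector_mult_scaleR inner_diff_left inner_diff_right field_simps)
    finally show "(B *v \<xi>) \<bullet> \<eta> \<le> (t * ((B *v \<xi>) \<bullet> \<xi>) + ((B *v \<eta>) \<bullet> \<eta>) / t) / 2" by simp
  qed
  note bound = this
  have "B *v (- \<xi>) = - (B *v \<xi>)"
    using matrix_vector_mult_scaleR[of B "-1" \<xi>] by simp
  then have "- ((B *v \<xi>) \<bullet> \<eta>) \<le> sqrt ((B *v \<xi>) \<bullet> \<xi>) * sqrt ((B *v \<eta>) \<bullet> \<eta>)"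
    using bound[of "- \<xi>" \<eta>] by simp
  with bound[of \<xi> \<eta>] show ?thesis by (intro abs_leI)
qed

text \<open>Where \<open>|t| > e\<close>, the first power is dominated by the \<open>p\<close>-th one. The free parameter \<open>e\<close> is chosen
  after integration, which yields estimates of the type of Jensen and Hoelder on finite measure spaces.\<close>

lemma truncated_power_bound:
  fixes t e p :: real
  assumes e: "e > 0" and p: "p \<ge> 1"
  shows "\<bar>t\<bar> \<le> e + e powr (1 - p) * \<bar>t\<bar> powr p"
proof (cases "\<bar>t\<bar> \<le> e")
  case False
  then have "\<bar>t\<bar> powr (1 - p) \<le> e powr (1 - p)" using e p by (intro powr_mono2') auto
  then have "\<bar>t\<bar> powr (1 - p) * \<bar>t\<bar> powr p \<le> e powr (1 - p) * \<bar>t\<bar> powr p"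
    by (intro mult_right_mono) auto
  moreover have "\<bar>t\<bar> powr (1 - p) * \<bar>t\<bar> powr p = \<bar>t\<bar>"
    using False e by (simp flip: powr_add)
  ultimately show ?thesis using e by linarith
qed (simp add: add_increasing2)

lemma power_sum_bound:
  fixes a b p :: real
  assumes "p \<ge> 0"
  shows "\<bar>a - b\<bar> powr p \<le> 2 powr p * (\<bar>a\<bar> powr p + \<bar>b\<bar> powr p)"
proof -
  have "\<bar>a - b\<bar> powr p \<le> (2 * max \<bar>a\<bar> \<bar>b\<bar>) powr p"
    using assms by (intro powr_mono2) auto
  also have "\<dots> = 2 powr p * max \<bar>a\<bar> \<bar>b\<bar> powr p" by (simp add: powr_mult)
  also have "\<dots> \<le> 2 powr p * (\<bar>a\<bar> powr p + \<bar>b\<bar> powr p)"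
    by (intro mult_left_mono) (auto simp: max_def)
  finally show ?thesis .
qed

text \<open>The product rule for a difference \<open>p a - q b\<close> with a third vector \<open>c\<close> inserted. In the
  application \<open>p\<close> and \<open>q\<close> are values of the derivative of a truncation, \<open>a\<close> and \<open>b\<close> are gradients
  that are close but not uniformly bounded, and \<open>c\<close> is a fixed bounded gradient near both, so that
  \<open>p - q\<close> never has to be multiplied with an uncontrolled gradient.\<close>

lemma three_term_bound:
  fixes a b c :: "'a::real_normed_vector" and p q :: real
  assumes p: "0 \<le> p" "p \<le> 1" and q: "0 \<le> q" "q \<le> 1"
  shows "(norm (p *\<^sub>R a - q *\<^sub>R b))\<^sup>2
    \<le> 3 * ((norm (a - b))\<^sup>2 + (norm (b - c))\<^sup>2 + \<bar>p - q\<bar> * (norm c)\<^sup>2)"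
proof -
  let ?x = "norm (a - b)" and ?y = "norm (b - c)" and ?z = "\<bar>p - q\<bar> * norm c"
  have "p *\<^sub>R a - q *\<^sub>R b = p *\<^sub>R (a - b) + (p - q) *\<^sub>R (b - c) + (p - q) *\<^sub>R c"
    by (simp add: algebra_simps)
  then have "norm (p *\<^sub>R a - q *\<^sub>R b) \<le> p * ?x + \<bar>p - q\<bar> * ?y + ?z"
    using p by (metis abs_of_nonneg norm_add_rule_thm norm_scaleR norm_triangle_mono order_refl)
  also have "\<dots> \<le> ?x + ?y + ?z"
    using p q by (intro add_mono mult_left_le_one_le) auto
  finally have "(norm (p *\<^sub>R a - q *\<^sub>R b))\<^sup>2 \<le> (?x + ?y + ?z)\<^sup>2" by (intro power_mono) auto
  also have "\<dots> \<le> 3 * (?x\<^sup>2 + ?y\<^sup>2 + ?z\<^sup>2)"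
    using sum_squares_ge_zero[of "?x - ?y" "?y - ?z"] zero_le_square[of "?x - ?z"]
    by (simp add: power2_eq_square algebra_simps)
  also have "?z\<^sup>2 \<le> \<bar>p - q\<bar> * (norm c)\<^sup>2"
  proof -
    have "\<bar>p - q\<bar> * \<bar>p - q\<bar> \<le> \<bar>p - q\<bar> * 1" using p q by (intro mult_left_mono) auto
    then have "\<bar>p - q\<bar> * \<bar>p - q\<bar> * (norm c)\<^sup>2 \<le> \<bar>p - q\<bar> * 1 * (norm c)\<^sup>2"
      by (rule mult_right_mono) simp
    then show ?thesis unfolding power_mult_distrib power2_eq_square[of "\<bar>p - q\<bar>"] by simp
  qed
  finally show ?thesis by simp
qed

lemma contraction_of_derivative:
  fixes T :: "real \<Rightarrow> real"
  assumes T: "\<And>t. (T has_real_derivative T' t) (at t)" and T': "\<And>t. 0 \<le> T' t" "\<And>t. T' t \<le> 1"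
  shows "\<bar>T s - T t\<bar> \<le> \<bar>s - t\<bar>"
proof -
  have "\<bar>T b - T a\<bar> \<le> b - a" if ab: "a < b" for a b
  proof -
    obtain z where "T b - T a = (b - a) * T' z"
      using MVT2[OF ab, of T T'] T by blast
    then show ?thesis using ab T'[of z] by (simp add: abs_mult mult_left_le)
  qed
  then show ?thesis
    by (cases s t rule: linorder_cases) (force simp: abs_minus_commute)+
qed

section \<open>Integral inequalities and limits of integrals\<close>

lemma integral_Cauchy_Schwarz:
  fixes g h :: "'a \<Rightarrow> real"
  assumes g: "integrable M (\<lambda>x. (g x)\<^sup>2)" and h: "integrable M (\<lambda>x. (h x)\<^sup>2)"
    and gh: "integrable M (\<lambda>x. g x * h x)"
  shows "(\<integral>x. g x * h x \<partial>M) \<le> sqrt (\<integral>x. (g x)\<^sup>2 \<partial>M) * sqrt (\<integral>x. (h x)\<^sup>2 \<partial>M)"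
proof (rule geometric_mean_bound)
  fix t :: real assume t: "t > 0"
  \<comment> \<open>Young's inequality with weight \<open>t\<close>.\<close>
  have "g x * h x \<le> (t * (g x)\<^sup>2 + (h x)\<^sup>2 / t) / 2" for x
  proof -
    have "0 \<le> (t * g x - h x)\<^sup>2 / t" using t by simp
    also have "\<dots> = t * (g x)\<^sup>2 + (h x)\<^sup>2 / t - 2 * (g x * h x)"
      using t by (simp add: power2_eq_square field_simps)
    finally show ?thesis by simp
  qed
  then have "(\<integral>x. g x * h x \<partial>M) \<le> (\<integral>x. (t * (g x)\<^sup>2 + (h x)\<^sup>2 / t) / 2 \<partial>M)"
    using g h by (intro integral_mono gh integrable_divide_zero integrable_add integrable_mult_right) auto
  also have "\<dots> = (t * (\<integral>x. (g x)\<^sup>2 \<partial>M) + (\<integral>x. (h x)\<^sup>2 \<partial>M) / t) / 2"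
    using g h by simp
  finally show "(\<integral>x. g x * h x \<partial>M) \<le> (t * (\<integral>x. (g x)\<^sup>2 \<partial>M) + (\<integral>x. (h x)\<^sup>2 \<partial>M) / t) / 2" .
qed auto

text \<open>The Hoelder estimate of an integral over a set by a power of its measure, with the
  non-optimal constant \<open>1 + \<integral>|R|\<^sup>r\<close> that comes from the truncated power bound.\<close>

lemma (in finite_measure) integral_on_small_set:
  fixes R :: "'a \<Rightarrow> real"
  assumes r: "r > 1" and R: "R \<in> borel_measurable M" and int: "integrable M (\<lambda>x. \<bar>R x\<bar> powr r)"
    and A: "A \<in> sets M"
  shows "(\<integral>x. \<bar>R x\<bar> * indicator A x \<partial>M) \<le> (1 + (\<integral>x. \<bar>R x\<bar> powr r \<partial>M)) * measure M A powr (1 - 1 / r)"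
proof (cases "measure M A = 0")
  case True
  then have "A \<in> null_sets M" using A by (simp add: emeasure_eq_measure null_setsI)
  then have "AE x in M. \<bar>R x\<bar> * indicator A x = 0"
    by (auto dest!: AE_not_in elim!: eventually_mono simp: indicator_def)
  then have "(\<integral>x. \<bar>R x\<bar> * indicator A x \<partial>M) = (\<integral>x. 0 \<partial>M)"
    using R A by (intro integral_cong_AE) auto
  then show ?thesis using True by simp
next
  case False
  let ?m = "measure M A" and ?I = "\<integral>x. \<bar>R x\<bar> powr r \<partial>M"
  have m: "?m > 0" using False by (simp add: zero_less_measure_iff)
  \<comment> \<open>This \<open>t\<close> balances the two terms of the truncated power bound: both become multiples of
    the same power of the measure of \<open>A\<close>.\<close>
  define t where "t = ?m powr (- 1 / r)"
  have t: "t > 0" using m by (simp add: t_def)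
  have ind: "integrable M (indicator A :: 'a \<Rightarrow> real)" using A by (simp add: emeasure_eq_measure)
  have bound: "\<bar>R x\<bar> * indicator A x \<le> t * indicator A x + t powr (1 - r) * \<bar>R x\<bar> powr r" for x
    using truncated_power_bound[OF t, of r "R x"] r by (auto simp: indicator_def)
  have "(\<integral>x. \<bar>R x\<bar> * indicator A x \<partial>M) \<le> (\<integral>x. t * indicator A x + t powr (1 - r) * \<bar>R x\<bar> powr r \<partial>M)"
  proof (rule integral_mono[OF Bochner_Integration.integrable_bound])
    show "integrable M (\<lambda>x. t * indicator A x + t powr (1 - r) * \<bar>R x\<bar> powr r)" 
      using ind int by (intro Bochner_Integration.integrable_add Bochner_Integration.integrable_mult_right)
    then show "integrable M (\<lambda>x. t * indicator A x + t powr (1 - r) * \<bar>R x\<bar> powr r)" .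
    show "AE x in M. norm (\<bar>R x\<bar> * indicator A x) \<le> norm (t * indicator A x + t powr (1 - r) * \<bar>R x\<bar> powr r)"
      using bound t by (intro AE_I2) (simp add: abs_mult order_trans[OF _ abs_ge_self])
  qed (use R A bound in auto)
  also have "\<dots> = t * ?m + t powr (1 - r) * ?I"
    using ind int A sets.sets_into_space[OF A] by (simp add: Int_absorb1)
  also have "t * ?m = ?m powr (1 - 1 / r)"
    using m powr_add[of ?m 1 "- 1 / r"] by (simp add: t_def)
  also have "t powr (1 - r) = ?m powr (1 - 1 / r)"
    using r by (simp add: t_def powr_powr diff_divide_distrib)
  finally show ?thesis by (simp add: algebra_simps)
qed

lemma L1_limit_unique:
  fixes M :: "'a measure" and \<phi> :: "nat \<Rightarrow> 'a \<Rightarrow> real" and u w :: "'a \<Rightarrow> real"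
  assumes \<phi>: "\<And>n. integrable M (\<phi> n)" and u: "integrable M u" and w: "integrable M w"
    and \<phi>u: "(\<lambda>n::nat. \<integral>x. \<bar>\<phi> n x - u x\<bar> \<partial>M) \<longlonglongrightarrow> 0" and \<phi>w: "(\<lambda>n. \<integral>x. \<bar>\<phi> n x - w x\<bar> \<partial>M) \<longlonglongrightarrow> 0"
  shows "AE x in M. u x = w x"
proof -
  have "(\<integral>x. \<bar>u x - w x\<bar> \<partial>M) \<le> (\<integral>x. \<bar>\<phi> n x - u x\<bar> \<partial>M) + (\<integral>x. \<bar>\<phi> n x - w x\<bar> \<partial>M)" for n
  proof -
    have "(\<integral>x. \<bar>u x - w x\<bar> \<partial>M) \<le> (\<integral>x. \<bar>\<phi> n x - u x\<bar> + \<bar>\<phi> n x - w x\<bar> \<partial>M)"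
      using \<phi> u w by (intro integral_mono) auto
    then show ?thesis using \<phi> u w by simp
  qed
  then have "(\<integral>x. \<bar>u x - w x\<bar> \<partial>M) \<le> 0"
    using tendsto_add[OF \<phi>u \<phi>w] by (intro LIMSEQ_le_const[of _ 0]) auto
  then have "(\<integral>x. \<bar>u x - w x\<bar> \<partial>M) = 0"
    by (intro antisym integral_nonneg_AE) auto
  then have "AE x in M. \<bar>u x - w x\<bar> = 0"
    using u w by (subst (asm) integral_nonneg_eq_0_iff_AE) auto
  then show ?thesis by simp
qed

text \<open>On a finite measure space the truncated power bound gives
  \<open>\<integral>|w| \<le> e \<mu>(M) + e\<^sup>1\<^sup>-\<^sup>p \<integral>|w|\<^sup>p\<close>; first \<open>e\<close> is made small, then \<open>n\<close> large. The integrability of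
  the powers is a separate hypothesis because the integral of a non-integrable function is 0, so
  that the limit alone would say nothing.\<close>

lemma (in finite_measure) Lp_limit_imp_L1_limit:
  fixes w :: "nat \<Rightarrow> 'a \<Rightarrow> real"
  assumes p: "p \<ge> 1" and meas: "\<And>n. w n \<in> borel_measurable M"
    and int: "\<And>n. integrable M (\<lambda>x. \<bar>w n x\<bar> powr p)"
    and lim: "(\<lambda>n. (\<integral>x. \<bar>w n x\<bar> powr p \<partial>M) powr (1 / p)) \<longlonglongrightarrow> 0"
  shows "integrable M (w n)" and "(\<lambda>n. \<integral>x. \<bar>w n x\<bar> \<partial>M) \<longlonglongrightarrow> 0"
proof -
  note young = truncated_power_bound[OF _ p]
  show intw: "integrable M (w n)" for n
  proof (rule Bochner_Integration.integrable_bound)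
    show "integrable M (\<lambda>x. 1 + 1 powr (1 - p) * \<bar>w n x\<bar> powr p)" using int by simp
    show "AE x in M. norm (w n x) \<le> norm (1 + 1 powr (1 - p) * \<bar>w n x\<bar> powr p)"
      using young[of 1] by (intro AE_I2) (auto simp: abs_of_nonneg add_nonneg_nonneg)
  qed (rule meas)
  let ?I = "\<lambda>n. \<integral>x. \<bar>w n x\<bar> powr p \<partial>M"
  have "(\<lambda>n. (?I n powr (1 / p)) powr p) \<longlonglongrightarrow> 0"
    by (rule tendsto_zero_powrI[OF lim tendsto_const]) (use p in auto)
  moreover have "(?I n powr (1 / p)) powr p = ?I n" for n
    using p by (simp add: powr_powr integral_nonneg_AE)
  ultimately have I: "?I \<longlonglongrightarrow> 0" by simp
  show "(\<lambda>n. \<integral>x. \<bar>w n x\<bar> \<partial>M) \<longlonglongrightarrow> 0"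
  proof (rule tendstoI)
    fix r :: real assume r: "r > 0"
    define m where "m = measure M (space M)"
    define e where "e = r / (2 * (m + 1))"
    have m: "m \<ge> 0" by (simp add: m_def)
    have e: "e > 0" and em: "e * m < r / 2" using r m by (auto simp: e_def field_simps)
    have "(\<lambda>n. e powr (1 - p) * ?I n) \<longlonglongrightarrow> e powr (1 - p) * 0" by (intro tendsto_intros I)
    then have "\<forall>\<^sub>F n in sequentially. e powr (1 - p) * ?I n < r / 2"
      using r by (intro order_tendstoD) auto
    then show "\<forall>\<^sub>F n in sequentially. dist (\<integral>x. \<bar>w n x\<bar> \<partial>M) 0 < r"
    proof eventually_elim
      case (elim n)
      have "(\<integral>x. \<bar>w n x\<bar> \<partial>M) \<le> (\<integral>x. e + e powr (1 - p) * \<bar>w n x\<bar> powr p \<partial>M)"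
        using intw int young[OF e] by (intro integral_mono) auto
      also have "\<dots> = e * m + e powr (1 - p) * ?I n"
        using int by (simp add: m_def)
      finally show ?case using elim em by (simp add: dist_real_def integral_nonneg_AE)
    qed
  qed
qed

lemma Lp_norm_cong_AE:
  assumes "u \<in> borel_measurable (lebesgue_on \<Omega>)" "w \<in> borel_measurable (lebesgue_on \<Omega>)"
    and "AE x in lebesgue_on \<Omega>. u x = w x"
  shows "Lp_norm \<Omega> p u = Lp_norm \<Omega> p w"
proof -
  have "(\<integral>x. \<bar>u x\<bar> powr p \<partial>lebesgue_on \<Omega>) = (\<integral>x. \<bar>w x\<bar> powr p \<partial>lebesgue_on \<Omega>)"
    using assms(3) by (intro integral_cong_AE) (use assms(1,2) in auto)
  then show ?thesis by (simp add: Lp_norm_def)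
qed

lemma integrable_continuous_on_bounded_set:
  fixes g :: "'a::euclidean_space \<Rightarrow> 'b::euclidean_space"
  assumes "open \<Omega>" "bounded \<Omega>" and g: "continuous_on UNIV g"
  shows "integrable (lebesgue_on \<Omega>) g"
proof -
  have O: "\<Omega> \<in> sets lebesgue" using assms by simp
  have lm: "\<Omega> \<in> lmeasurable" using assms by (simp add: bounded_set_imp_lmeasurable)
  interpret finite_measure "lebesgue_on \<Omega>" using lm by (rule finite_measure_lebesgue_on)
  have "compact (g ` closure \<Omega>)"
    using assms by (intro compact_continuous_image) (auto intro: continuous_on_subset)
  then obtain c where c: "\<And>x. x \<in> closure \<Omega> \<Longrightarrow> norm (g x) \<le> c"
    by (metis compact_imp_bounded bounded_iff imageI)
  show ?thesis
  proof (rule integrable_const_bound)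
    show "AE x in lebesgue_on \<Omega>. norm (g x) \<le> c"
      using c closure_subset by (intro AE_I2) auto
    show "g \<in> borel_measurable (lebesgue_on \<Omega>)"
      using g O continuous_imp_measurable_on_sets_lebesgue continuous_on_subset by blast
  qed
qed

section \<open>Smooth truncations and the iteration over levels\<close>

text \<open>The test functions of the level-set method are truncations of the solution between two levels.
  A truncation that is \<open>C\<^sup>1\<close> with a Lipschitz derivative maps the space of test functions into
  itself and obeys the classical chain rule there. The price is only that its plateau has height \<open>d\<close>
  when the levels are \<open>2d\<close> apart.\<close>

lemma smooth_truncation_exists:
  fixes k d :: real
  assumes k: "k \<ge> 0" and d: "d > 0"
  obtains T T' :: "real \<Rightarrow> real" and L :: real where
    "\<And>t. (T has_real_derivative T' t) (at t)" "T 0 = 0"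
    "\<And>t. 0 \<le> T' t" "\<And>t. T' t \<le> 1" "L-lipschitz_on UNIV T'"
    "\<And>t. \<bar>T t\<bar> \<le> d" "\<And>t. \<bar>t\<bar> \<le> k \<Longrightarrow> T t = 0"
    "\<And>t. \<bar>t\<bar> \<ge> k + 2 * d \<Longrightarrow> \<bar>T t\<bar> = d" "\<And>t. t * T t = \<bar>t\<bar> * \<bar>T t\<bar>"
proof -
  \<comment> \<open>The tent over \<open>[k, k + 2d]\<close> of height 1, as a combination of positive parts, and its primitive,
    which climbs from 0 to the area \<open>d\<close> of the tent. The truncation is the odd extension.\<close>
  define hat where "hat t = (max 0 (t - k) - 2 * max 0 (t - k - d) + max 0 (t - k - 2 * d)) / d" for t
  define ramp where
    "ramp t = ((max 0 (t - k))\<^sup>2 - 2 * (max 0 (t - k - d))\<^sup>2 + (max 0 (t - k - 2 * d))\<^sup>2) / (2 * d)" for t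
  \<comment> \<open>The square of a positive part is \<open>C\<^sup>1\<close> also at its kink.\<close>
  have sq: "((\<lambda>t. (max 0 (t - c))\<^sup>2) has_real_derivative 2 * max 0 (t - c)) (at t)" for c t :: real
  proof -
    consider "t < c" | "t > c" | "t = c" by linarith
    then show ?thesis
    proof cases
      case 1
      have "((\<lambda>_. 0) has_real_derivative 0) (at t)" by simp
      then have "((\<lambda>t. (max 0 (t - c))\<^sup>2) has_real_derivative 0) (at t)"
        by (rule DERIV_cong_ev[THEN iffD1, rotated -1, OF _ refl _ refl])
          (use eventually_nhds_in_open[of "{..<c}" t] 1 in \<open>auto elim!: eventually_mono simp: max_def\<close>)
      with 1 show ?thesis by (simp add: max_def)
    next
      case 2
      have "((\<lambda>t. (t - c)\<^sup>2) has_real_derivative 2 * (t - c)) (at t)"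
        by (auto intro!: derivative_eq_intros)
      then have "((\<lambda>t. (max 0 (t - c))\<^sup>2) has_real_derivative 2 * (t - c)) (at t)"
        by (rule DERIV_cong_ev[THEN iffD1, rotated -1, OF _ refl _ refl])
          (use eventually_nhds_in_open[of "{c<..}" t] 2 in \<open>auto elim!: eventually_mono simp: max_def\<close>)
      with 2 show ?thesis by (simp add: max_def)
    next
      case 3
      have "((\<lambda>h::real. (max 0 h)\<^sup>2 / h) \<longlongrightarrow> 0) (at 0)"
      proof (rule tendsto_rabs_zero_cancel, rule tendsto_sandwich[OF _ _ tendsto_const])
        show "\<forall>\<^sub>F h in at 0. \<bar>(max 0 h)\<^sup>2 / h\<bar> \<le> \<bar>h::real\<bar>"
          by (rule always_eventually) (auto simp: max_def power2_eq_square)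
        show "((\<lambda>h. \<bar>h::real\<bar>) \<longlongrightarrow> 0) (at 0)" by (auto intro!: tendsto_eq_intros)
      qed auto
      with 3 show ?thesis by (simp add: DERIV_def)
    qed
  qed
  have ramp': "(ramp has_real_derivative hat t) (at t)" for t
  proof -
    have "((\<lambda>t. ((max 0 (t - k))\<^sup>2 - 2 * (max 0 (t - (k + d)))\<^sup>2 + (max 0 (t - (k + 2 * d)))\<^sup>2) / (2 * d))
        has_real_derivative (2 * max 0 (t - k) - 2 * (2 * max 0 (t - (k + d))) + 2 * max 0 (t - (k + 2 * d))) / (2 * d)) (at t)"
      by (intro DERIV_cdivide DERIV_add DERIV_diff DERIV_cmult sq)
    moreover have "(2 * max 0 (t - k) - 2 * (2 * max 0 (t - (k + d))) + 2 * max 0 (t - (k + 2 * d))) / (2 * d) = hat t"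
      using d by (simp add: hat_def field_simps)
    ultimately show ?thesis by (simp add: ramp_def[abs_def] algebra_simps)
  qed
  have hat01: "0 \<le> hat t" "hat t \<le> 1" and hat0: "t \<le> k \<Longrightarrow> hat t = 0" for t
    using d by (auto simp: hat_def max_def field_simps)
  have hat_lip: "\<bar>hat s - hat t\<bar> \<le> 4 / d * \<bar>s - t\<bar>" for s t
  proof -
    have "\<bar>(max 0 (s - k) - 2 * max 0 (s - k - d) + max 0 (s - k - 2 * d))
        - (max 0 (t - k) - 2 * max 0 (t - k - d) + max 0 (t - k - 2 * d))\<bar> \<le> 4 * \<bar>s - t\<bar>"
      by (auto simp: max_def abs_if split: if_splits)
    then show ?thesis using d unfolding hat_def diff_divide_distrib[symmetric] abs_divide
      by (simp add: divide_right_mono)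
  qed
  have ramp0: "t \<le> k \<Longrightarrow> ramp t = 0" for t using d by (simp add: ramp_def)
  have ramp_d: "t \<ge> k + 2 * d \<Longrightarrow> ramp t = d" for t
    using d by (simp add: ramp_def max_def power2_eq_square field_simps)
  have mono: "ramp s \<le> ramp t" if "s \<le> t" for s t
    by (rule DERIV_nonneg_imp_nondecreasing[OF that]) (use ramp' hat01 in blast)
  have ramp_le: "0 \<le> ramp t" "ramp t \<le> d" for t
    using mono[of "min t k" t] mono[of t "max t (k + 2 * d)"] ramp0[of "min t k"] ramp_d[of "max t (k + 2 * d)"]
    by auto
  show ?thesis
  proof (rule that[of "\<lambda>t. ramp t - ramp (- t)" "\<lambda>t. hat t + hat (- t)" "8 / d"])
    fix t :: real
    have "((\<lambda>t. ramp (- t)) has_real_derivative - hat (- t)) (at t)"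
      using DERIV_chain2[OF ramp' DERIV_minus[OF DERIV_ident]] by simp
    from DERIV_diff[OF ramp' this]
    show "((\<lambda>t. ramp t - ramp (- t)) has_real_derivative hat t + hat (- t)) (at t)" by simp
    show "0 \<le> hat t + hat (- t)" using hat01 by simp
    show "hat t + hat (- t) \<le> 1"
      using hat01(2)[of t] hat01(2)[of "- t"] hat0[of t] hat0[of "- t"] k by linarith
    show "\<bar>ramp t - ramp (- t)\<bar> \<le> d" using ramp_le[of t] ramp_le[of "- t"] by linarith
    show "ramp t - ramp (- t) = 0" if "\<bar>t\<bar> \<le> k"
      using that ramp0[of t] ramp0[of "- t"] by auto
    show "\<bar>ramp t - ramp (- t)\<bar> = d" if "\<bar>t\<bar> \<ge> k + 2 * d"
      using that ramp0[of t] ramp0[of "- t"] ramp_d[of t] ramp_d[of "- t"] k d by (cases "t \<ge> 0") auto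
    show "t * (ramp t - ramp (- t)) = \<bar>t\<bar> * \<bar>ramp t - ramp (- t)\<bar>"
      using ramp0[of t] ramp0[of "- t"] ramp_le[of t] ramp_le[of "- t"] k by (cases "t \<ge> 0") auto
  next
    show "(8 / d)-lipschitz_on UNIV (\<lambda>t. hat t + hat (- t))"
    proof (rule lipschitz_onI)
      fix s t :: real
      show "dist (hat s + hat (- s)) (hat t + hat (- t)) \<le> 8 / d * dist s t"
      proof -
        have "\<bar>- s - - t\<bar> = \<bar>s - t\<bar>" by simp
        then have "\<bar>hat (- s) - hat (- t)\<bar> \<le> 4 / d * \<bar>s - t\<bar>" using hat_lip[of "- s" "- t"] by metis
        moreover have "8 / d * \<bar>s - t\<bar> = 4 / d * \<bar>s - t\<bar> + 4 / d * \<bar>s - t\<bar>" by simp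
        ultimately show ?thesis using hat_lip[of s t] unfolding dist_real_def by linarith
      qed
    qed (use d in simp)
  qed simp
qed

text \<open>Superlinear decay (\<open>\<beta> > 1\<close>) forces \<open>g\<close> to vanish at a finite level. Along levels whose gaps
  halve, the loss \<open>2 powr \<gamma>\<close> from the shrinking gap is beaten by the gain from the exponent
  \<open>\<beta>\<close> once \<open>g\<close> decays geometrically at rate \<open>\<mu> = \<gamma> / (\<beta> - 1)\<close>.\<close>

lemma Stampacchia_iteration:
  fixes g :: "real \<Rightarrow> real"
  assumes nonneg: "\<And>k. 0 \<le> g k" and mono: "\<And>k h. k \<le> h \<Longrightarrow> g h \<le> g k"
    and decay: "\<And>k h. k\<^sub>0 \<le> k \<Longrightarrow> k < h \<Longrightarrow> g h \<le> M / (h - k) powr \<gamma> * g k powr \<beta>"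
    and M: "M \<ge> 0" and \<gamma>: "\<gamma> > 0" and \<beta>: "\<beta> > 1"
  shows "\<exists>k. g k = 0"
proof -
  define \<mu> where "\<mu> = \<gamma> / (\<beta> - 1)"
  have \<mu>: "\<mu> > 0" and \<mu>_eq: "\<mu> * \<beta> = \<gamma> + \<mu>" using \<gamma> \<beta> by (auto simp: \<mu>_def field_simps)
  \<comment> \<open>With the levels \<open>K n\<close> below, \<open>g (K n)\<close> is to decay like \<open>2 powr (- \<mu> n)\<close>; the step from
    \<open>n\<close> to \<open>n + 1\<close> holds as soon as \<open>d powr \<gamma>\<close> dominates \<open>D - 1\<close>. The summand 1
    keeps \<open>d\<close> positive.\<close>
  define D where "D = M * 2 powr (\<gamma> + \<mu>) * g k\<^sub>0 powr (\<beta> - 1) + 1"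
  define d where "d = D powr (1 / \<gamma>)"
  have D: "D > 0" using M by (simp add: D_def add_nonneg_pos)
  then have d: "d > 0" and d_powr: "d powr \<gamma> = D" using \<gamma> by (auto simp: d_def powr_powr)
  define K where "K n = k\<^sub>0 + d * (1 - 2 powr - real n)" for n :: nat
  have K_ge: "k\<^sub>0 \<le> K n" for n
    using d powr_mono[of "- real n" 0 2] by (simp add: K_def)
  have K_step: "K (Suc n) - K n = d * 2 powr - (real n + 1)" for n
  proof -
    have "2 powr - real n = 2 * (2 powr - (real n + 1) :: real)"
      using powr_add[of 2 1 "- (real n + 1)"] by simp
    then show ?thesis by (simp add: K_def algebra_simps)
  qed
  have geometric: "g (K n) \<le> g k\<^sub>0 * 2 powr (- \<mu> * real n)" for n
  proof (induction n)
    case 0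
    show ?case by (simp add: K_def)
  next
    case (Suc n)
    have "g (K (Suc n)) \<le> M / (K (Suc n) - K n) powr \<gamma> * g (K n) powr \<beta>"
      using K_ge K_step[of n] d by (intro decay) (auto simp: algebra_simps)
    also have "\<dots> \<le> M / (K (Suc n) - K n) powr \<gamma> * (g k\<^sub>0 * 2 powr (- \<mu> * real n)) powr \<beta>"
      using Suc nonneg M \<beta> by (intro mult_left_mono powr_mono2) auto
    also have "\<dots> = M / (D * 2 powr (- (real n + 1) * \<gamma>)) * (g k\<^sub>0 powr \<beta> * 2 powr (- \<mu> * real n * \<beta>))"
      unfolding K_step using d nonneg by (simp add: powr_mult powr_powr d_powr)
    also have "\<dots> = M * g k\<^sub>0 powr \<beta> * (2 powr ((real n + 1) * \<gamma>) * 2 powr (- \<mu> * real n * \<beta>)) / D"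
    proof -
      have "2 powr (- (real n + 1) * \<gamma>) = 1 / (2 powr ((real n + 1) * \<gamma>) :: real)"
        by (simp only: mult_minus_left powr_minus_divide)
      then show ?thesis by simp
    qed
    also have "2 powr ((real n + 1) * \<gamma>) * 2 powr (- \<mu> * real n * \<beta>)
        = 2 powr (\<gamma> + \<mu>) * (2 powr (- \<mu> * real (Suc n)) :: real)"
    proof -
      have "(real n + 1) * \<gamma> + (- \<mu> * real n * \<beta>) = (real n + 1) * \<gamma> - real n * (\<mu> * \<beta>)" by simp
      also have "\<dots> = (\<gamma> + \<mu>) + (- \<mu> * real (Suc n))" unfolding \<mu>_eq by (simp add: algebra_simps)
      finally show ?thesis unfolding powr_add[symmetric] by simp
    qed
    also have "M * g k\<^sub>0 powr \<beta> * (2 powr (\<gamma> + \<mu>) * (2 powr (- \<mu> * real (Suc n)))) / D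
        = g k\<^sub>0 * 2 powr (- \<mu> * real (Suc n)) * ((D - 1) / D)"
    proof -
      have "g k\<^sub>0 powr \<beta> = g k\<^sub>0 * g k\<^sub>0 powr (\<beta> - 1)"
        using nonneg[of k\<^sub>0] powr_add[of "g k\<^sub>0" 1 "\<beta> - 1"] by (cases "g k\<^sub>0 = 0") auto
      then show ?thesis by (simp add: D_def algebra_simps)
    qed
    also have "\<dots> \<le> g k\<^sub>0 * 2 powr (- \<mu> * real (Suc n)) * 1"
      using D nonneg by (intro mult_left_mono) auto
    finally show ?case by simp
  qed
  have "g (k\<^sub>0 + d) \<le> g k\<^sub>0 * (2 powr - \<mu>) ^ n" for n
  proof -
    have "K n \<le> k\<^sub>0 + d" using d by (simp add: K_def)
    then have "g (k\<^sub>0 + d) \<le> g (K n)" by (rule mono)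
    also note geometric[of n]
    also have "2 powr (- \<mu> * real n) = (2 powr - \<mu>) ^ n" by (simp add: powr_powr flip: powr_realpow)
    finally show ?thesis .
  qed
  moreover have "(\<lambda>n. g k\<^sub>0 * (2 powr - \<mu>) ^ n) \<longlonglongrightarrow> g k\<^sub>0 * 0"
    using \<mu> powr_less_mono[of "- \<mu>" 0 "2::real"] by (intro tendsto_intros LIMSEQ_realpow_zero) auto
  ultimately have "g (k\<^sub>0 + d) \<le> 0" by (intro LIMSEQ_le_const) auto
  with nonneg[of "k\<^sub>0 + d"] show ?thesis by (intro exI[of _ "k\<^sub>0 + d"]) simp
qed

section \<open>Gradients of test functions\<close>

lemma locally_lipschitz_imp_continuous:
  assumes "locally_lipschitz c" shows "continuous_on UNIV c"
proof -
  have "isCont c x" for x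
  proof -
    obtain e L where e: "e > 0" and "L-lipschitz_on (cball x e) c"
      using assms unfolding locally_lipschitz_def by blast
    then have "continuous_on (cball x e) c" by (blast intro: lipschitz_on_continuous_on)
    then show ?thesis
      using e by (simp add: continuous_on_interior)
  qed
  then show ?thesis by (simp add: continuous_at_imp_continuous_on)
qed

lemma grad_inner:
  assumes "u differentiable (at x)"
  shows "frechet_derivative u (at x) h = grad u x \<bullet> h"
proof -
  have lin: "linear (frechet_derivative u (at x))"
    using assms by (simp add: frechet_derivative_works has_derivative_linear)
  have "frechet_derivative u (at x) h = frechet_derivative u (at x) (\<Sum>i\<in>UNIV. (h $ i) *\<^sub>R axis i 1)"
    by (metis basis_expansion scalar_mult_eq_scaleR)
  also have "\<dots> = (\<Sum>i\<in>UNIV. (h $ i) * frechet_derivative u (at x) (axis i 1))"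
    using lin by (simp add: linear_sum linear_scale)
  finally show ?thesis by (simp add: grad_def inner_vec_def mult.commute)
qed

lemma has_derivative_grad:
  assumes "u differentiable (at x)"
  shows "(u has_derivative (\<lambda>h. grad u x \<bullet> h)) (at x)"
proof -
  have "frechet_derivative u (at x) = (\<lambda>h. grad u x \<bullet> h)"
    using grad_inner[OF assms] by blast
  then show ?thesis using assms by (simp add: frechet_derivative_works)
qed

lemma grad_unique:
  assumes "(u has_derivative (\<lambda>h. g \<bullet> h)) (at x)"
  shows "grad u x = g"
  using frechet_derivative_at[OF assms, symmetric]
  by (simp add: grad_def vec_eq_iff inner_axis)

lemma C1_0_has_derivative:
  assumes "u \<in> C1_0 \<Omega>"
  shows "(u has_derivative (\<lambda>h. grad u x \<bullet> h)) (at x)"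
  using assms by (intro has_derivative_grad) (simp add: C1_0_def)

lemma C1_0_continuous:
  assumes "u \<in> C1_0 \<Omega>" shows "continuous_on UNIV u" "continuous_on UNIV (grad u)"
  using assms by (auto simp: C1_0_def intro!: continuous_at_imp_continuous_on differentiable_imp_continuous_within)

lemma grad_diff:
  assumes "u \<in> C1_0 \<Omega>" "v \<in> C1_0 \<Omega>"
  shows "grad (\<lambda>x. u x - v x) x = grad u x - grad v x"
  by (rule grad_unique)
    (use assms[THEN C1_0_has_derivative, of x] in \<open>auto intro!: derivative_eq_intros simp: inner_diff_left\<close>)

lemma C1_0_diff:
  assumes u: "u \<in> C1_0 \<Omega>" and v: "v \<in> C1_0 \<Omega>"
  shows "(\<lambda>x. u x - v x) \<in> C1_0 \<Omega>"
proof -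
  obtain K where K: "compact K" "K \<subseteq> \<Omega>" "\<And>x. x \<notin> K \<Longrightarrow> u x = 0" using u by (auto simp: C1_0_def)
  obtain L where L: "compact L" "L \<subseteq> \<Omega>" "\<And>x. x \<notin> L \<Longrightarrow> v x = 0" using v by (auto simp: C1_0_def)
  have "grad (\<lambda>x. u x - v x) = (\<lambda>x. grad u x - grad v x)"
    using grad_diff[OF u v] by blast
  moreover have "continuous_on UNIV (\<lambda>x. grad u x - grad v x)"
    using u v by (intro continuous_on_diff C1_0_continuous)
  moreover have "compact (K \<union> L)" "K \<union> L \<subseteq> \<Omega>" "\<forall>x. x \<notin> K \<union> L \<longrightarrow> u x - v x = 0"
    using K L by auto
  ultimately show ?thesis
    using u v unfolding C1_0_def by (auto intro!: differentiable_diff)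
qed

lemma grad_compose:
  assumes u: "u \<in> C1_0 \<Omega>" and T: "\<And>t. (T has_real_derivative T' t) (at t)"
  shows "grad (\<lambda>x. T (u x)) x = T' (u x) *\<^sub>R grad u x"
proof (rule grad_unique)
  have "((\<lambda>x. T (u x)) has_derivative (\<lambda>h. T' (u x) * (grad u x \<bullet> h))) (at x)"
    using has_derivative_compose[OF C1_0_has_derivative[OF u, of x] T[of "u x", unfolded has_field_derivative_def]]
    by simp
  then show "((\<lambda>x. T (u x)) has_derivative (\<lambda>h. T' (u x) *\<^sub>R grad u x \<bullet> h)) (at x)" by simp
qed

lemma C1_0_compose:
  assumes u: "u \<in> C1_0 \<Omega>" and T: "\<And>t. (T has_real_derivative T' t) (at t)"
    and T': "continuous_on UNIV T'" and T0: "T 0 = 0"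
  shows "(\<lambda>x. T (u x)) \<in> C1_0 \<Omega>"
proof -
  obtain K where K: "compact K" "K \<subseteq> \<Omega>" "\<And>x. x \<notin> K \<Longrightarrow> u x = 0" using u by (auto simp: C1_0_def)
  have "(\<lambda>x. T (u x)) differentiable (at x)" for x
    using has_derivative_compose[OF C1_0_has_derivative[OF u, of x] T[of "u x", unfolded has_field_derivative_def]]
    by (rule differentiableI)
  moreover have "grad (\<lambda>x. T (u x)) = (\<lambda>x. T' (u x) *\<^sub>R grad u x)"
    using grad_compose[where T = T, OF u T] by blast
  moreover have "continuous_on UNIV (\<lambda>x. T' (u x) *\<^sub>R grad u x)"
    by (intro continuous_intros continuous_on_compose2[OF T'] C1_0_continuous[OF u]) auto
  ultimately show ?thesis
    using K T0 unfolding C1_0_def by auto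
qed

lemma X_gradient_inner: "norm (X_gradient X u x) ^ 2 = (\<Sum>j\<in>UNIV. (X j x \<bullet> grad u x)\<^sup>2)"
  unfolding power2_norm_eq_inner
  by (subst inner_vec_def) (simp add: X_gradient_def power2_eq_square)

lemma X_gradient_diff:
  assumes "u \<in> C1_0 \<Omega>" "v \<in> C1_0 \<Omega>"
  shows "X_gradient X (\<lambda>x. u x - v x) x = X_gradient X u x - X_gradient X v x"
  by (simp add: X_gradient_def grad_diff[OF assms] inner_diff_right vec_eq_iff)

lemma X_gradient_compose:
  assumes "u \<in> C1_0 \<Omega>" "\<And>t. (T has_real_derivative T' t) (at t)"
  shows "X_gradient X (\<lambda>x. T (u x)) x = T' (u x) *\<^sub>R X_gradient X u x"
  by (simp add: X_gradient_def grad_compose[where T = T, OF assms] vec_eq_iff)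

lemma X_gradient_continuous:
  assumes "u \<in> C1_0 \<Omega>" "\<And>j. continuous_on UNIV (X j)"
  shows "continuous_on UNIV (X_gradient X u)"
  unfolding X_gradient_def using assms C1_0_continuous[OF assms(1)]
  by (intro continuous_on_vec_lambda continuous_on_inner)

section \<open>The norm of the completion and truncations of Cauchy sequences\<close>

text \<open>Boundedness of the domain and continuity of the fields together make the \<open>X\<close>-gradient of a
  test function bounded, hence square integrable.\<close>

locale bounded_X_domain =
  fixes \<Omega> :: "(real^'n) set" and X :: "'m::finite \<Rightarrow> real^'n \<Rightarrow> real^'n"
  assumes open_domain: "open \<Omega>" and bounded_domain: "bounded \<Omega>"
    and continuous_fields: "\<And>j. continuous_on UNIV (X j)"

begin

lemma finite_domain: "finite_measure (lebesgue_on \<Omega>)"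
  using open_domain bounded_domain by (simp add: finite_measure_lebesgue_on bounded_set_imp_lmeasurable)

lemma continuous_integrable: "continuous_on UNIV g \<Longrightarrow> integrable (lebesgue_on \<Omega>) g"
  for g :: "real^'n \<Rightarrow> real"
  using open_domain bounded_domain by (rule integrable_continuous_on_bounded_set)

lemma C1_0_integrable: "v \<in> C1_0 \<Omega> \<Longrightarrow> integrable (lebesgue_on \<Omega>) v"
  by (intro continuous_integrable C1_0_continuous)

lemma X_norm_nonneg [simp]: "0 \<le> X_norm \<Omega> X u"
  by (simp add: X_norm_def integral_nonneg_AE)

lemma X_norm_commute:
  assumes "u \<in> C1_0 \<Omega>" "v \<in> C1_0 \<Omega>"
  shows "X_norm \<Omega> X (\<lambda>x. u x - v x) = X_norm \<Omega> X (\<lambda>x. v x - u x)"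
  using assms by (simp add: X_norm_def X_gradient_diff norm_minus_commute)

lemma X_norm_power2: "(X_norm \<Omega> X u)\<^sup>2 = (\<integral>x. (norm (X_gradient X u x))\<^sup>2 \<partial>lebesgue_on \<Omega>)"
  by (simp add: X_norm_def integral_nonneg_AE)

lemma X_gradient_sq_integrable:
  assumes "u \<in> C1_0 \<Omega>"
  shows "integrable (lebesgue_on \<Omega>) (\<lambda>x. (norm (X_gradient X u x))\<^sup>2)"
  using assms continuous_fields by (intro continuous_integrable continuous_intros X_gradient_continuous)

lemma X_gradient_norm_product:
  assumes "u \<in> C1_0 \<Omega>" "v \<in> C1_0 \<Omega>"
  shows "integrable (lebesgue_on \<Omega>) (\<lambda>x. norm (X_gradient X u x) * norm (X_gradient X v x))"
    and "(\<integral>x. norm (X_gradient X u x) * norm (X_gradient X v x) \<partial>lebesgue_on \<Omega>)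
           \<le> X_norm \<Omega> X u * X_norm \<Omega> X v"
proof -
  show int: "integrable (lebesgue_on \<Omega>) (\<lambda>x. norm (X_gradient X u x) * norm (X_gradient X v x))"
    using assms continuous_fields by (intro continuous_integrable continuous_intros X_gradient_continuous)
  show "(\<integral>x. norm (X_gradient X u x) * norm (X_gradient X v x) \<partial>lebesgue_on \<Omega>)
           \<le> X_norm \<Omega> X u * X_norm \<Omega> X v"
    unfolding X_norm_def
    by (rule integral_Cauchy_Schwarz[OF X_gradient_sq_integrable X_gradient_sq_integrable int]) (use assms in auto)
qed

lemma X_norm_triangle:
  assumes u: "u \<in> C1_0 \<Omega>" and v: "v \<in> C1_0 \<Omega>"
  shows "X_norm \<Omega> X u \<le> X_norm \<Omega> X (\<lambda>x. u x - v x) + X_norm \<Omega> X v"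
proof (rule power2_le_imp_le)
  let ?w = "\<lambda>x. u x - v x"
  have w: "?w \<in> C1_0 \<Omega>" using u v by (rule C1_0_diff)
  note I = X_gradient_sq_integrable X_gradient_norm_product
  have "(X_norm \<Omega> X u)\<^sup>2 \<le> (\<integral>x. (norm (X_gradient X ?w x))\<^sup>2
      + 2 * (norm (X_gradient X ?w x) * norm (X_gradient X v x)) + (norm (X_gradient X v x))\<^sup>2 \<partial>lebesgue_on \<Omega>)"
    unfolding X_norm_power2
  proof (rule integral_mono)
    fix x
    have "norm (X_gradient X u x) \<le> norm (X_gradient X ?w x) + norm (X_gradient X v x)"
      by (simp add: X_gradient_diff[OF u v] norm_diff_triangle_ineq norm_triangle_sub add.commute)
    then have "(norm (X_gradient X u x))\<^sup>2 \<le> (norm (X_gradient X ?w x) + norm (X_gradient X v x))\<^sup>2"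
      by (intro power_mono) auto
    then show "(norm (X_gradient X u x))\<^sup>2 \<le> (norm (X_gradient X ?w x))\<^sup>2
      + 2 * (norm (X_gradient X ?w x) * norm (X_gradient X v x)) + (norm (X_gradient X v x))\<^sup>2"
      by (simp add: power2_sum algebra_simps)
  next
    show "integrable (lebesgue_on \<Omega>) (\<lambda>x. (norm (X_gradient X ?w x))\<^sup>2
      + 2 * (norm (X_gradient X ?w x) * norm (X_gradient X v x)) + (norm (X_gradient X v x))\<^sup>2)"
      using I(1)[OF w] I(1)[OF v] I(2)[OF w v] by simp
  qed (rule I(1)[OF u])
  also have "\<dots> = (X_norm \<Omega> X ?w)\<^sup>2
      + 2 * (\<integral>x. norm (X_gradient X ?w x) * norm (X_gradient X v x) \<partial>lebesgue_on \<Omega>) + (X_norm \<Omega> X v)\<^sup>2"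
    using I(1)[OF w] I(1)[OF v] I(2)[OF w v] by (simp add: X_norm_power2)
  also have "\<dots> \<le> (X_norm \<Omega> X ?w + X_norm \<Omega> X v)\<^sup>2"
    using I(3)[OF w v] by (simp add: power2_sum)
  finally show "(X_norm \<Omega> X u)\<^sup>2 \<le> (X_norm \<Omega> X ?w + X_norm \<Omega> X v)\<^sup>2" .
qed (intro add_nonneg_nonneg X_norm_nonneg)

lemma X_norm_reverse_triangle:
  assumes "u \<in> C1_0 \<Omega>" "v \<in> C1_0 \<Omega>"
  shows "\<bar>X_norm \<Omega> X u - X_norm \<Omega> X v\<bar> \<le> X_norm \<Omega> X (\<lambda>x. u x - v x)"
  using X_norm_triangle[OF assms] X_norm_triangle[OF assms(2,1)] X_norm_commute[OF assms]
  by simp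

lemma X_Cauchy_C1_0: "\<phi> \<in> X_Cauchy \<Omega> X \<Longrightarrow> \<phi> n \<in> C1_0 \<Omega>"
  by (simp add: X_Cauchy_def)

lemma X_Cauchy_norm_convergent:
  assumes \<phi>: "\<phi> \<in> X_Cauchy \<Omega> X"
  shows "convergent (\<lambda>n. X_norm \<Omega> X (\<phi> n))"
proof -
  have \<phi>0: "\<phi> n \<in> C1_0 \<Omega>" for n using \<phi> by (simp add: X_Cauchy_def)
  have "Cauchy (\<lambda>n. X_norm \<Omega> X (\<phi> n))"
  proof (rule CauchyI)
    fix e :: real assume "e > 0"
    then obtain M where "\<forall>m\<ge>M. \<forall>n\<ge>M. X_norm \<Omega> X (\<lambda>x. \<phi> m x - \<phi> n x) < e"
      using \<phi> unfolding X_Cauchy_def by blast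
    then show "\<exists>M. \<forall>m\<ge>M. \<forall>n\<ge>M. norm (X_norm \<Omega> X (\<phi> m) - X_norm \<Omega> X (\<phi> n)) < e"
      using le_less_trans[OF X_norm_reverse_triangle[OF \<phi>0 \<phi>0]] by (auto intro!: exI[of _ M])
  qed
  then show ?thesis by (simp add: Cauchy_convergent_iff)
qed

lemma X_equiv_refl:
  assumes "\<phi> \<in> X_Cauchy \<Omega> X" shows "\<phi> \<in> X_equiv \<Omega> X `` {\<phi>}"
proof -
  have "X_gradient X (\<lambda>x. \<phi> n x - \<phi> n x) x = 0" for n x
    using assms X_gradient_diff[of "\<phi> n" \<Omega> "\<phi> n" X x] by (simp add: X_Cauchy_def)
  then have "X_norm \<Omega> X (\<lambda>x. \<phi> n x - \<phi> n x) = 0" for n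
    by (simp add: X_norm_def del: diff_self)
  then show ?thesis using assms by (simp add: X_equiv_def)
qed

text \<open>The norm of the completion is defined as the common limit over all representatives; the reverse
  triangle inequality shows that this limit exists and can be computed along any one of them.\<close>

lemma HX_norm_limit:
  assumes \<phi>: "\<phi> \<in> X_Cauchy \<Omega> X"
  shows "(\<lambda>n. X_norm \<Omega> X (\<phi> n)) \<longlonglongrightarrow> HX_norm \<Omega> X (X_equiv \<Omega> X `` {\<phi>})"
proof -
  obtain l where l: "(\<lambda>n. X_norm \<Omega> X (\<phi> n)) \<longlonglongrightarrow> l"
    using X_Cauchy_norm_convergent[OF assms] by (auto simp: convergent_def)
  have "(\<lambda>n. X_norm \<Omega> X (\<psi> n)) \<longlonglongrightarrow> l" if \<psi>: "\<psi> \<in> X_equiv \<Omega> X `` {\<phi>}" for \<psi>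
  proof -
    have C: "\<psi> n \<in> C1_0 \<Omega>" "\<phi> n \<in> C1_0 \<Omega>" for n
      using \<psi> \<phi> by (auto simp: X_equiv_def X_Cauchy_def)
    have "(\<lambda>n. X_norm \<Omega> X (\<phi> n) - X_norm \<Omega> X (\<psi> n)) \<longlonglongrightarrow> 0"
      by (rule tendsto_rabs_zero_cancel, rule tendsto_sandwich[OF _ _ tendsto_const])
        (use \<psi> X_norm_reverse_triangle[OF C(2) C(1)] in \<open>auto simp: X_equiv_def\<close>)
    from tendsto_diff[OF l this] show ?thesis by simp
  qed
  then have "\<forall>\<psi>\<in>X_equiv \<Omega> X `` {\<phi>}. (\<lambda>n. X_norm \<Omega> X (\<psi> n)) \<longlonglongrightarrow> l" by blast
  then have "HX_norm \<Omega> X (X_equiv \<Omega> X `` {\<phi>}) = l"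
    unfolding HX_norm_def using X_equiv_refl[OF \<phi>] by (blast intro: the_equality LIMSEQ_unique)
  with l show ?thesis by simp
qed

lemma X_gradient_bounded:
  assumes "u \<in> C1_0 \<Omega>"
  obtains K where "K > 0" "\<And>x. x \<in> \<Omega> \<Longrightarrow> (norm (X_gradient X u x))\<^sup>2 \<le> K"
proof -
  have "compact ((\<lambda>x. (norm (X_gradient X u x))\<^sup>2) ` closure \<Omega>)"
    using assms continuous_fields bounded_domain
    by (intro compact_continuous_image continuous_intros continuous_on_subset[OF X_gradient_continuous]) auto
  then obtain K where K: "K > 0" "\<And>y. y \<in> (\<lambda>x. (norm (X_gradient X u x))\<^sup>2) ` closure \<Omega> \<Longrightarrow> norm y \<le> K"
    by (metis compact_imp_bounded bounded_pos)
  show ?thesis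
    using K(1)
  proof (rule that)
    fix x assume "x \<in> \<Omega>"
    then have "x \<in> closure \<Omega>" using closure_subset by blast
    then show "(norm (X_gradient X u x))\<^sup>2 \<le> K" using K(2) by force
  qed
qed

text \<open>In the application \<open>z\<close> is fixed while \<open>v\<close> and \<open>w\<close> vary, so that \<open>K\<close> is a constant. Since the
  derivative of \<open>T\<close> takes values in the unit interval and is Lipschitz, the square of \<open>T'(v) - T'(w)\<close>
  is controlled by the first power of \<open>v - w\<close>; this is why convergence in \<open>L\<^sup>1\<close> is enough.\<close>

lemma X_norm_compose_difference:
  assumes v: "v \<in> C1_0 \<Omega>" and w: "w \<in> C1_0 \<Omega>" and z: "z \<in> C1_0 \<Omega>"
    and T: "\<And>t. (T has_real_derivative T' t) (at t)" "T 0 = 0"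
    and T': "\<And>t. 0 \<le> T' t" "\<And>t. T' t \<le> 1" and lip: "L-lipschitz_on UNIV T'"
    and K: "\<And>x. x \<in> \<Omega> \<Longrightarrow> (norm (X_gradient X z x))\<^sup>2 \<le> K" "K > 0"
  shows "(X_norm \<Omega> X (\<lambda>x. T (v x) - T (w x)))\<^sup>2
    \<le> 3 * ((X_norm \<Omega> X (\<lambda>x. v x - w x))\<^sup>2 + (X_norm \<Omega> X (\<lambda>x. w x - z x))\<^sup>2
           + L * K * (\<integral>x. \<bar>v x - w x\<bar> \<partial>lebesgue_on \<Omega>))"
proof -
  have cont: "continuous_on UNIV T'" using lip by (rule lipschitz_on_continuous_on)
  have Tv: "(\<lambda>x. T (v x)) \<in> C1_0 \<Omega>" using v T(1) cont T(2) by (rule C1_0_compose)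
  have Tw: "(\<lambda>x. T (w x)) \<in> C1_0 \<Omega>" using w T(1) cont T(2) by (rule C1_0_compose)
  have I: "integrable (lebesgue_on \<Omega>) (\<lambda>x. \<bar>v x - w x\<bar>)"
    using v w C1_0_integrable by auto
  note J = X_gradient_sq_integrable[OF C1_0_diff[OF v w]] X_gradient_sq_integrable[OF C1_0_diff[OF w z]]
  have "(X_norm \<Omega> X (\<lambda>x. T (v x) - T (w x)))\<^sup>2 \<le>
    (\<integral>x. 3 * ((norm (X_gradient X (\<lambda>x. v x - w x) x))\<^sup>2 + (norm (X_gradient X (\<lambda>x. w x - z x) x))\<^sup>2
       + L * K * \<bar>v x - w x\<bar>) \<partial>lebesgue_on \<Omega>)"
    unfolding X_norm_power2
  proof (rule integral_mono)
    show "integrable (lebesgue_on \<Omega>) (\<lambda>x. (norm (X_gradient X (\<lambda>x. T (v x) - T (w x)) x))\<^sup>2)"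
      using Tv Tw by (intro X_gradient_sq_integrable C1_0_diff)
    show "integrable (lebesgue_on \<Omega>) (\<lambda>x. 3 * ((norm (X_gradient X (\<lambda>x. v x - w x) x))\<^sup>2
        + (norm (X_gradient X (\<lambda>x. w x - z x) x))\<^sup>2 + L * K * \<bar>v x - w x\<bar>))"
      using I J by simp
    fix x assume "x \<in> space (lebesgue_on \<Omega>)"
    then have x: "x \<in> \<Omega>" by simp
    have "\<bar>T' (v x) - T' (w x)\<bar> * (norm (X_gradient X z x))\<^sup>2 \<le> (L * \<bar>v x - w x\<bar>) * K"
      using lipschitz_onD[OF lip, of "v x" "w x"] K(1)[OF x] by (intro mult_mono) (auto simp: dist_real_def)
    then show "(norm (X_gradient X (\<lambda>x. T (v x) - T (w x)) x))\<^sup>2 \<le> 3 * ((norm (X_gradient X (\<lambda>x. v x - w x) x))\<^sup>2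
        + (norm (X_gradient X (\<lambda>x. w x - z x) x))\<^sup>2 + L * K * \<bar>v x - w x\<bar>)"
      using three_term_bound[of "T' (v x)" "T' (w x)" "X_gradient X v x" "X_gradient X w x" "X_gradient X z x"] T'
      unfolding X_gradient_diff[OF Tv Tw] X_gradient_diff[OF v w] X_gradient_diff[OF w z]
        X_gradient_compose[where T = T, OF v T(1)] X_gradient_compose[where T = T, OF w T(1)]
      by (simp add: mult_ac)
  qed
  also have "\<dots> = 3 * ((X_norm \<Omega> X (\<lambda>x. v x - w x))\<^sup>2 + (X_norm \<Omega> X (\<lambda>x. w x - z x))\<^sup>2
           + L * K * (\<integral>x. \<bar>v x - w x\<bar> \<partial>lebesgue_on \<Omega>))"
    using I J by (simp add: X_norm_power2)
  finally show ?thesis .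
qed

text \<open>The step that puts truncations into the completion: one late member of the sequence serves as the
  fixed function \<open>z\<close> of the previous estimate, and then the \<open>L\<^sup>1\<close> convergence of the sequence
  makes the remaining term small.\<close>

lemma X_Cauchy_compose:
  assumes \<phi>: "\<phi> \<in> X_Cauchy \<Omega> X" and u: "integrable (lebesgue_on \<Omega>) u"
    and lim: "(\<lambda>n. \<integral>x. \<bar>\<phi> n x - u x\<bar> \<partial>lebesgue_on \<Omega>) \<longlonglongrightarrow> 0"
    and T: "\<And>t. (T has_real_derivative T' t) (at t)" "T 0 = 0"
    and T': "\<And>t. 0 \<le> T' t" "\<And>t. T' t \<le> 1" and lip: "L-lipschitz_on UNIV T'"
  shows "(\<lambda>n x. T (\<phi> n x)) \<in> X_Cauchy \<Omega> X"
proof -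
  note C = X_Cauchy_C1_0[OF \<phi>]
  have cont: "continuous_on UNIV T'" using lip by (rule lipschitz_on_continuous_on)
  have "\<exists>M. \<forall>m\<ge>M. \<forall>n\<ge>M. X_norm \<Omega> X (\<lambda>x. T (\<phi> m x) - T (\<phi> n x)) < e" if e: "e > 0" for e
  proof -
    obtain M where M: "\<And>m n. m \<ge> M \<Longrightarrow> n \<ge> M \<Longrightarrow> X_norm \<Omega> X (\<lambda>x. \<phi> m x - \<phi> n x) < e / 3"
    proof -
      have "e / 3 > 0" using e by simp
      with \<phi> show ?thesis unfolding X_Cauchy_def by (blast intro: that)
    qed
    obtain K where K: "K > 0" "\<And>x. x \<in> \<Omega> \<Longrightarrow> (norm (X_gradient X (\<phi> M) x))\<^sup>2 \<le> K"
      using X_gradient_bounded[OF C] by blast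
    have L: "L \<ge> 0" using lip by (rule lipschitz_on_nonneg)
    \<comment> \<open>The index \<open>M\<close> is chosen before \<open>m\<close> and \<open>n\<close> grow, so \<open>K\<close> is a constant here and the
      \<open>L\<^sup>1\<close> distance of \<open>\<phi> m\<close> and \<open>\<phi> n\<close> can be made small against it. Each of the three
      terms of the difference bound is to be at most \<open>e\<^sup>2 / 9\<close>.\<close>
    define \<delta> where "\<delta> = e\<^sup>2 / (18 * (L * K + 1))"
    have LK: "L * K \<ge> 0" using L K by simp
    then have \<delta>: "\<delta> > 0" using e by (simp add: \<delta>_def)
    have \<delta>_bound: "L * K * (2 * \<delta>) \<le> e\<^sup>2 / 9"
    proof -
      have "L * K * (2 * \<delta>) \<le> (L * K + 1) * (2 * \<delta>)" using \<delta> by (intro mult_right_mono) auto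
      also have "\<dots> = e\<^sup>2 / 9" using LK by (simp add: \<delta>_def field_simps)
      finally show ?thesis .
    qed
    obtain M' where M': "\<And>n. n \<ge> M' \<Longrightarrow> (\<integral>x. \<bar>\<phi> n x - u x\<bar> \<partial>lebesgue_on \<Omega>) < \<delta>"
      using order_tendstoD(2)[OF lim \<delta>] by (auto simp: eventually_sequentially)
    have "X_norm \<Omega> X (\<lambda>x. T (\<phi> m x) - T (\<phi> n x)) < e" if mn: "m \<ge> max M M'" "n \<ge> max M M'" for m n
    proof (rule power2_less_imp_less)
      have "(\<integral>x. \<bar>\<phi> m x - \<phi> n x\<bar> \<partial>lebesgue_on \<Omega>)
          \<le> (\<integral>x. \<bar>\<phi> m x - u x\<bar> + \<bar>\<phi> n x - u x\<bar> \<partial>lebesgue_on \<Omega>)"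
        using C1_0_integrable[OF C] u by (intro integral_mono) auto
      also have "\<dots> \<le> 2 * \<delta>"
        using C1_0_integrable[OF C] u M'[of m] M'[of n] mn by simp
      finally have "L * K * (\<integral>x. \<bar>\<phi> m x - \<phi> n x\<bar> \<partial>lebesgue_on \<Omega>) \<le> e\<^sup>2 / 9"
        using LK \<delta>_bound by (meson mult_left_mono order_trans)
      moreover have "(X_norm \<Omega> X (\<lambda>x. \<phi> i x - \<phi> j x))\<^sup>2 < (e / 3)\<^sup>2" if "i \<ge> M" "j \<ge> M" for i j
        using M[OF that] by (intro power_strict_mono) auto
      from this[of m n] this[of n M] have "(X_norm \<Omega> X (\<lambda>x. \<phi> m x - \<phi> n x))\<^sup>2 < e\<^sup>2 / 9"
        "(X_norm \<Omega> X (\<lambda>x. \<phi> n x - \<phi> M x))\<^sup>2 < e\<^sup>2 / 9"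
        using mn by (auto simp: power_divide)
      ultimately show "(X_norm \<Omega> X (\<lambda>x. T (\<phi> m x) - T (\<phi> n x)))\<^sup>2 < e\<^sup>2"
        using X_norm_compose_difference[OF C C C T T' lip K(2,1), of m n] by simp
    qed (use e in simp)
    then show ?thesis by blast
  qed
  moreover have "(\<lambda>x. T (\<phi> n x)) \<in> C1_0 \<Omega>" for n
    using C T(1) cont T(2) by (rule C1_0_compose)
  ultimately show ?thesis by (simp add: X_Cauchy_def)
qed

text \<open>Whatever exponent is used to attach a function to a class, the attached function is the
  \<open>L\<^sup>1\<close> limit of every representative. This lets functions for different exponents be identified.\<close>

lemma HX_fun_imp_L1_limit:
  assumes \<phi>: "\<phi> \<in> X_Cauchy \<Omega> X" and w: "HX_fun \<Omega> p (X_equiv \<Omega> X `` {\<phi>}) w" and p: "p \<ge> 1"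
  shows "integrable (lebesgue_on \<Omega>) w" and "(\<lambda>n. \<integral>x. \<bar>\<phi> n x - w x\<bar> \<partial>lebesgue_on \<Omega>) \<longlonglongrightarrow> 0"
proof -
  interpret finite_measure "lebesgue_on \<Omega>" by (rule finite_domain)
  have [measurable]: "w \<in> borel_measurable (lebesgue_on \<Omega>)"
    and wp: "integrable (lebesgue_on \<Omega>) (\<lambda>x. \<bar>w x\<bar> powr p)"
    and lim: "(\<lambda>n. Lp_norm \<Omega> p (\<lambda>x. \<phi> n x - w x)) \<longlonglongrightarrow> 0"
    using w X_equiv_refl[OF \<phi>] by (auto simp: HX_fun_def Lp_def)
  note C = X_Cauchy_C1_0[OF \<phi>]
  have int: "integrable (lebesgue_on \<Omega>) (\<phi> n)" for n using C by (rule C1_0_integrable)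
  then have [measurable]: "\<phi> n \<in> borel_measurable (lebesgue_on \<Omega>)" for n by (rule borel_measurable_integrable)
  have "integrable (lebesgue_on \<Omega>) (\<lambda>x. \<bar>\<phi> n x\<bar> powr p)" for n
    using C1_0_continuous(1)[OF C] p by (intro continuous_integrable continuous_on_powr' continuous_intros) auto
  then have "integrable (lebesgue_on \<Omega>) (\<lambda>x. 2 powr p * (\<bar>\<phi> n x\<bar> powr p + \<bar>w x\<bar> powr p))" for n
    using wp by (intro Bochner_Integration.integrable_add Bochner_Integration.integrable_mult_right)
  then have "integrable (lebesgue_on \<Omega>) (\<lambda>x. \<bar>\<phi> n x - w x\<bar> powr p)" for n
    by (rule Bochner_Integration.integrable_bound[of _ _ "\<lambda>x. \<bar>\<phi> n x - w x\<bar> powr p" for n])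
      (use p in \<open>auto intro!: AE_I2 power_sum_bound\<close>)
  note L = Lp_limit_imp_L1_limit[where w = "\<lambda>n x. \<phi> n x - w x", OF p _ this lim[unfolded Lp_norm_def]]
  show "(\<lambda>n. \<integral>x. \<bar>\<phi> n x - w x\<bar> \<partial>lebesgue_on \<Omega>) \<longlonglongrightarrow> 0" by (rule L) measurable
  have "integrable (lebesgue_on \<Omega>) (\<lambda>x. \<phi> 0 x - w x)" by (rule L) measurable
  from Bochner_Integration.integrable_diff[OF int[of 0] this] show "integrable (lebesgue_on \<Omega>) w" by simp
qed

end

section \<open>The elliptic form on the completion\<close>

locale X_elliptic_form = bounded_X_domain \<Omega> X
  for \<Omega> :: "(real^'n) set" and X :: "'m::finite \<Rightarrow> real^'n \<Rightarrow> real^'n" +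
  fixes B :: "real^'n \<Rightarrow> real^'n^'n" and \<Lambda> :: real
  assumes B_measurable: "\<And>i j. (\<lambda>x. B x $ i $ j) \<in> borel_measurable lebesgue"
    and B_symmetric: "\<And>x i j. B x $ i $ j = B x $ j $ i"
    and \<Lambda>_pos: "\<Lambda> > 0"
    and B_lower: "\<And>x \<xi>. x \<in> \<Omega> \<Longrightarrow> (\<Sum>j\<in>UNIV. (X j x \<bullet> \<xi>)\<^sup>2) / \<Lambda> \<le> (B x *v \<xi>) \<bullet> \<xi>"
    and B_upper: "\<And>x \<xi>. x \<in> \<Omega> \<Longrightarrow> (B x *v \<xi>) \<bullet> \<xi> \<le> \<Lambda> * (\<Sum>j\<in>UNIV. (X j x \<bullet> \<xi>)\<^sup>2)"

begin

definition energy :: "(real^'n \<Rightarrow> real) \<Rightarrow> (real^'n \<Rightarrow> real) \<Rightarrow> real" where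
  "energy u v = (\<integral>x. (B x *v grad u x) \<bullet> grad v x \<partial>lebesgue_on \<Omega>)"

lemma B_nonneg: "x \<in> \<Omega> \<Longrightarrow> 0 \<le> (B x *v \<xi>) \<bullet> \<xi>"
  using \<Lambda>_pos by (intro order_trans[OF _ B_lower] divide_nonneg_pos sum_nonneg) auto

lemma form_pointwise_bound:
  assumes "x \<in> \<Omega>"
  shows "\<bar>(B x *v grad u x) \<bullet> grad v x\<bar> \<le> \<Lambda> * (norm (X_gradient X u x) * norm (X_gradient X v x))"
proof -
  have "sqrt ((B x *v grad w x) \<bullet> grad w x) \<le> sqrt \<Lambda> * norm (X_gradient X w x)" for w
    using B_upper[OF assms, of "grad w x"] \<Lambda>_pos
    by (intro real_le_lsqrt) (auto simp: power_mult_distrib X_gradient_inner)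
  then have "sqrt ((B x *v grad u x) \<bullet> grad u x) * sqrt ((B x *v grad v x) \<bullet> grad v x)
      \<le> (sqrt \<Lambda> * norm (X_gradient X u x)) * (sqrt \<Lambda> * norm (X_gradient X v x))"
    using \<Lambda>_pos B_nonneg[OF assms] by (intro mult_mono) auto
  also have "\<dots> = \<Lambda> * (norm (X_gradient X u x) * norm (X_gradient X v x))"
    using \<Lambda>_pos real_sqrt_mult_self[of \<Lambda>] by (metis abs_of_pos mult.assoc mult.left_commute)
  finally show ?thesis
    using semidefinite_form_Cauchy_Schwarz[OF B_symmetric B_nonneg[OF assms]] by (meson order_trans)
qed

lemma form_integrable:
  assumes u: "u \<in> C1_0 \<Omega>" and v: "v \<in> C1_0 \<Omega>"
  shows "integrable (lebesgue_on \<Omega>) (\<lambda>x. (B x *v grad u x) \<bullet> grad v x)"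
proof (rule Bochner_Integration.integrable_bound)
  show "integrable (lebesgue_on \<Omega>) (\<lambda>x. \<Lambda> * (norm (X_gradient X u x) * norm (X_gradient X v x)))"
    using X_gradient_norm_product[OF u v] by simp
  have [measurable]: "(\<lambda>x. B x $ i $ j) \<in> borel_measurable (lebesgue_on \<Omega>)" for i j
    using B_measurable by (rule measurable_restrict_space1)
  have [measurable]: "(\<lambda>x. grad w x $ i) \<in> borel_measurable (lebesgue_on \<Omega>)" if "w \<in> C1_0 \<Omega>" for w i
    using C1_0_continuous(2)[OF that] open_domain
    by (intro continuous_imp_measurable_on_sets_lebesgue continuous_intros) (auto intro: continuous_on_subset)
  have "(\<lambda>x. \<Sum>i\<in>UNIV. (\<Sum>j\<in>UNIV. B x $ i $ j * grad u x $ j) * grad v x $ i) \<in> borel_measurable (lebesgue_on \<Omega>)"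
    using u v by measurable
  then show "(\<lambda>x. (B x *v grad u x) \<bullet> grad v x) \<in> borel_measurable (lebesgue_on \<Omega>)"
    by (subst inner_vec_def) (simp add: matrix_vector_mult_def)
  show "AE x in lebesgue_on \<Omega>. norm ((B x *v grad u x) \<bullet> grad v x)
      \<le> norm (\<Lambda> * (norm (X_gradient X u x) * norm (X_gradient X v x)))"
    using form_pointwise_bound \<Lambda>_pos by (intro AE_I2) (auto simp: abs_mult)
qed

lemma energy_bound:
  assumes u: "u \<in> C1_0 \<Omega>" and v: "v \<in> C1_0 \<Omega>"
  shows "\<bar>energy u v\<bar> \<le> \<Lambda> * (X_norm \<Omega> X u * X_norm \<Omega> X v)"
proof -
  have "\<bar>energy u v\<bar> \<le> (\<integral>x. \<Lambda> * (norm (X_gradient X u x) * norm (X_gradient X v x)) \<partial>lebesgue_on \<Omega>)"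
    unfolding energy_def
    using u v by (intro integral_abs_bound_integral form_integrable integrable_mult_right X_gradient_norm_product)
      (auto intro: form_pointwise_bound)
  also have "\<dots> \<le> \<Lambda> * (X_norm \<Omega> X u * X_norm \<Omega> X v)"
    using X_gradient_norm_product(2)[OF u v] \<Lambda>_pos by simp
  finally show ?thesis .
qed

lemma energy_diff:
  assumes "u \<in> C1_0 \<Omega>" "u' \<in> C1_0 \<Omega>" "v \<in> C1_0 \<Omega>"
  shows "energy (\<lambda>x. u x - u' x) v = energy u v - energy u' v"
    and "energy v (\<lambda>x. u x - u' x) = energy v u - energy v u'"
  using assms
  by (simp_all add: form_integrable energy_def grad_diff matrix_vector_mult_diff_distrib inner_diff_left inner_diff_right)

text \<open>Continuity of the bilinear form along pairs of sequences: one argument is changed at a time.\<close>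

lemma energy_difference_bound:
  assumes C: "u \<in> C1_0 \<Omega>" "u' \<in> C1_0 \<Omega>" "v \<in> C1_0 \<Omega>" "v' \<in> C1_0 \<Omega>"
  shows "\<bar>energy u v - energy u' v'\<bar> \<le> \<Lambda> * (X_norm \<Omega> X (\<lambda>x. u x - u' x) * X_norm \<Omega> X v
           + X_norm \<Omega> X u' * X_norm \<Omega> X (\<lambda>x. v x - v' x))"
proof -
  have "energy u v - energy u' v' = energy (\<lambda>x. u x - u' x) v + energy u' (\<lambda>x. v x - v' x)"
    using C by (simp add: energy_diff)
  then show ?thesis
    using energy_bound[OF C1_0_diff[OF C(1,2)] C(3)] energy_bound[OF C(2) C1_0_diff[OF C(3,4)]]
    by (simp add: distrib_left)
qed

lemma energy_convergent:
  assumes \<phi>: "\<phi> \<in> X_Cauchy \<Omega> X" and \<psi>: "\<psi> \<in> X_Cauchy \<Omega> X"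
  shows "convergent (\<lambda>n. energy (\<phi> n) (\<psi> n))"
proof -
  have C: "\<phi> n \<in> C1_0 \<Omega>" "\<psi> n \<in> C1_0 \<Omega>" for n using \<phi> \<psi> by (auto simp: X_Cauchy_def)
  obtain P where P: "P > 0" "\<And>n. X_norm \<Omega> X (\<phi> n) \<le> P"
    using convergent_imp_Bseq[OF X_Cauchy_norm_convergent[OF \<phi>]] by (auto simp: Bseq_def)
  obtain S where S: "S > 0" "\<And>n. X_norm \<Omega> X (\<psi> n) \<le> S"
    using convergent_imp_Bseq[OF X_Cauchy_norm_convergent[OF \<psi>]] by (auto simp: Bseq_def)
  have "Cauchy (\<lambda>n. energy (\<phi> n) (\<psi> n))"
  proof (rule CauchyI)
    fix e :: real assume e: "e > 0"
    define d where "d = e / (\<Lambda> * (P + S))"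
    have PS: "\<Lambda> * (P + S) > 0" using P(1) S(1) \<Lambda>_pos by simp
    then have d: "d > 0" using e by (simp add: d_def)
    have "\<Lambda> * (d * S + P * d) = d * (\<Lambda> * (P + S))" by (simp add: algebra_simps)
    also have "\<dots> = e" using PS unfolding d_def by (simp only: nonzero_divide_eq_eq times_divide_eq_left)
    finally have d_eq: "\<Lambda> * (d * S + P * d) = e" .
    obtain M1 where M1: "\<And>m n. m \<ge> M1 \<Longrightarrow> n \<ge> M1 \<Longrightarrow> X_norm \<Omega> X (\<lambda>x. \<phi> m x - \<phi> n x) < d"
      using \<phi> d unfolding X_Cauchy_def by blast
    obtain M2 where M2: "\<And>m n. m \<ge> M2 \<Longrightarrow> n \<ge> M2 \<Longrightarrow> X_norm \<Omega> X (\<lambda>x. \<psi> m x - \<psi> n x) < d"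
      using \<psi> d unfolding X_Cauchy_def by blast
    have "\<bar>energy (\<phi> m) (\<psi> m) - energy (\<phi> n) (\<psi> n)\<bar> < e" if mn: "m \<ge> max M1 M2" "n \<ge> max M1 M2" for m n
    proof -
      have "X_norm \<Omega> X (\<lambda>x. \<phi> m x - \<phi> n x) * X_norm \<Omega> X (\<psi> m)
           + X_norm \<Omega> X (\<phi> n) * X_norm \<Omega> X (\<lambda>x. \<psi> m x - \<psi> n x) < d * S + P * d"
      proof (rule add_le_less_mono)
        show "X_norm \<Omega> X (\<lambda>x. \<phi> m x - \<phi> n x) * X_norm \<Omega> X (\<psi> m) \<le> d * S"
          using M1[of m n] mn S d by (intro mult_mono) auto
        have "X_norm \<Omega> X (\<phi> n) * X_norm \<Omega> X (\<lambda>x. \<psi> m x - \<psi> n x)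
            \<le> P * X_norm \<Omega> X (\<lambda>x. \<psi> m x - \<psi> n x)"
          using P by (intro mult_right_mono) auto
        also have "\<dots> < P * d" using M2[of m n] mn P by simp
        finally show "X_norm \<Omega> X (\<phi> n) * X_norm \<Omega> X (\<lambda>x. \<psi> m x - \<psi> n x) < P * d" .
      qed
      then have "\<Lambda> * (X_norm \<Omega> X (\<lambda>x. \<phi> m x - \<phi> n x) * X_norm \<Omega> X (\<psi> m)
           + X_norm \<Omega> X (\<phi> n) * X_norm \<Omega> X (\<lambda>x. \<psi> m x - \<psi> n x)) < e"
        using \<Lambda>_pos by (subst d_eq[symmetric]) simp
      with energy_difference_bound[of "\<phi> m" "\<phi> n" "\<psi> m" "\<psi> n"] C show ?thesis by auto
    qed
    then show "\<exists>M. \<forall>m\<ge>M. \<forall>n\<ge>M. norm (energy (\<phi> m) (\<psi> m) - energy (\<phi> n) (\<psi> n)) < e"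
      by (auto intro!: exI[of _ "max M1 M2"])
  qed
  then show ?thesis by (simp add: Cauchy_convergent_iff)
qed

lemma HX_form_limit:
  assumes \<phi>: "\<phi> \<in> X_Cauchy \<Omega> X" and \<psi>: "\<psi> \<in> X_Cauchy \<Omega> X"
  shows "(\<lambda>n. energy (\<phi> n) (\<psi> n)) \<longlonglongrightarrow> HX_form \<Omega> B (X_equiv \<Omega> X `` {\<phi>}) (X_equiv \<Omega> X `` {\<psi>})"
proof -
  obtain l where l: "(\<lambda>n. energy (\<phi> n) (\<psi> n)) \<longlonglongrightarrow> l"
    using energy_convergent[OF assms] by (auto simp: convergent_def)
  \<comment> \<open>The limit does not depend on the representatives.\<close>
  have "(\<lambda>n. energy (\<phi>' n) (\<psi>' n)) \<longlonglongrightarrow> l"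
    if "\<phi>' \<in> X_equiv \<Omega> X `` {\<phi>}" "\<psi>' \<in> X_equiv \<Omega> X `` {\<psi>}" for \<phi>' \<psi>'
  proof -
    have C: "\<phi> n \<in> C1_0 \<Omega>" "\<phi>' n \<in> C1_0 \<Omega>" "\<psi> n \<in> C1_0 \<Omega>" "\<psi>' n \<in> C1_0 \<Omega>" for n
      using that \<phi> \<psi> by (auto simp: X_equiv_def X_Cauchy_def)
    have \<phi>': "\<phi>' \<in> X_Cauchy \<Omega> X" using that by (simp add: X_equiv_def)
    have "(\<lambda>n. \<Lambda> * (X_norm \<Omega> X (\<lambda>x. \<phi> n x - \<phi>' n x) * X_norm \<Omega> X (\<psi> n)
           + X_norm \<Omega> X (\<phi>' n) * X_norm \<Omega> X (\<lambda>x. \<psi> n x - \<psi>' n x))) \<longlonglongrightarrow>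
        \<Lambda> * (0 * HX_norm \<Omega> X (X_equiv \<Omega> X `` {\<psi>}) + HX_norm \<Omega> X (X_equiv \<Omega> X `` {\<phi>'}) * 0)"
      using that by (intro tendsto_intros HX_norm_limit \<psi> \<phi>') (auto simp: X_equiv_def)
    then have "(\<lambda>n. \<bar>energy (\<phi> n) (\<psi> n) - energy (\<phi>' n) (\<psi>' n)\<bar>)
        \<longlonglongrightarrow> \<Lambda> * (0 * HX_norm \<Omega> X (X_equiv \<Omega> X `` {\<psi>}) + HX_norm \<Omega> X (X_equiv \<Omega> X `` {\<phi>'}) * 0)"
      by (rule tendsto_sandwich[where f = "\<lambda>_. 0", rotated 3])
        (auto intro!: always_eventually energy_difference_bound C)
    then have "(\<lambda>n. \<bar>energy (\<phi> n) (\<psi> n) - energy (\<phi>' n) (\<psi>' n)\<bar>) \<longlonglongrightarrow> 0" by simp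
    from tendsto_diff[OF l tendsto_rabs_zero_cancel[OF this]] show ?thesis by simp
  qed
  then have "\<forall>\<phi>'\<in>X_equiv \<Omega> X `` {\<phi>}. \<forall>\<psi>'\<in>X_equiv \<Omega> X `` {\<psi>}. (\<lambda>n. energy (\<phi>' n) (\<psi>' n)) \<longlonglongrightarrow> l"
    by blast
  then have "HX_form \<Omega> B (X_equiv \<Omega> X `` {\<phi>}) (X_equiv \<Omega> X `` {\<psi>}) = l"
    unfolding HX_form_def energy_def[symmetric]
    using X_equiv_refl[OF \<phi>] X_equiv_refl[OF \<psi>] by (blast intro: the_equality LIMSEQ_unique)
  with l show ?thesis by simp
qed

text \<open>Testing with \<open>T(u)\<close> produces the factor \<open>T'(u)\<close>, while the norm of \<open>T(u)\<close> contains its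
  square; as \<open>0 \<le> T' \<le> 1\<close>, the former dominates and the form controls the full norm of the
  truncation.\<close>

lemma energy_truncation_lower:
  assumes u: "u \<in> C1_0 \<Omega>" and T: "\<And>t. (T has_real_derivative T' t) (at t)"
    and T'_cont: "continuous_on UNIV T'" and T0: "T 0 = 0" and T': "\<And>t. 0 \<le> T' t" "\<And>t. T' t \<le> 1"
  shows "(X_norm \<Omega> X (\<lambda>x. T (u x)))\<^sup>2 / \<Lambda> \<le> energy u (\<lambda>x. T (u x))"
proof -
  have Tu: "(\<lambda>x. T (u x)) \<in> C1_0 \<Omega>" using u T T'_cont T0 by (rule C1_0_compose)
  have "(\<integral>x. (norm (X_gradient X (\<lambda>x. T (u x)) x))\<^sup>2 / \<Lambda> \<partial>lebesgue_on \<Omega>) \<le> energy u (\<lambda>x. T (u x))"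
    unfolding energy_def
  proof (rule integral_mono)
    fix x assume "x \<in> space (lebesgue_on \<Omega>)"
    then have x: "x \<in> \<Omega>" by simp
    have "(norm (X_gradient X (\<lambda>x. T (u x)) x))\<^sup>2 / \<Lambda> = (T' (u x))\<^sup>2 * ((norm (X_gradient X u x))\<^sup>2 / \<Lambda>)"
      by (simp add: X_gradient_compose[where T = T, OF u T] power_mult_distrib)
    also have "\<dots> \<le> (T' (u x))\<^sup>2 * ((B x *v grad u x) \<bullet> grad u x)"
      using B_lower[OF x] by (intro mult_left_mono) (auto simp: X_gradient_inner)
    also have "\<dots> \<le> T' (u x) * ((B x *v grad u x) \<bullet> grad u x)"
      using T' B_nonneg[OF x] by (intro mult_right_mono) (auto simp: power2_eq_square mult_left_le_one_le)
    also have "\<dots> = (B x *v grad u x) \<bullet> grad (\<lambda>x. T (u x)) x"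
      by (simp add: grad_compose[where T = T, OF u T])
    finally show "(norm (X_gradient X (\<lambda>x. T (u x)) x))\<^sup>2 / \<Lambda> \<le> (B x *v grad u x) \<bullet> grad (\<lambda>x. T (u x)) x" .
  qed (use X_gradient_sq_integrable form_integrable u Tu in auto)
  then show ?thesis by (simp add: X_norm_power2)
qed

section \<open>Decay of the level sets and boundedness\<close>

text \<open>If \<open>\<phi>\<close> represents \<open>u\<close>, the sequence \<open>T(\<phi> n)\<close> represents \<open>T(u)\<close>. The lower bound for the form holds
  for every member of the sequence and passes to the limit.\<close>

lemma truncation_test_function:
  assumes U: "U \<in> HX \<Omega> X" "HX_fun \<Omega> 1 U u"
    and emb: "\<And>p. p \<in> {1, s} \<Longrightarrow> continuous_embedding \<Omega> X p" and s: "s \<ge> 1"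
    and C: "\<And>V v. V \<in> HX \<Omega> X \<Longrightarrow> HX_fun \<Omega> s V v \<Longrightarrow> Lp_norm \<Omega> s v \<le> C * HX_norm \<Omega> X V"
    and T: "\<And>t. (T has_real_derivative T' t) (at t)" "T 0 = 0"
    and T': "\<And>t. 0 \<le> T' t" "\<And>t. T' t \<le> 1" and lip: "L-lipschitz_on UNIV T'"
  obtains V where "V \<in> HX \<Omega> X" "HX_fun \<Omega> 1 V (\<lambda>x. T (u x))"
    "(HX_norm \<Omega> X V)\<^sup>2 / \<Lambda> \<le> HX_form \<Omega> B U V" "Lp_norm \<Omega> s (\<lambda>x. T (u x)) \<le> C * HX_norm \<Omega> X V"
proof -
  obtain \<phi> where \<phi>: "\<phi> \<in> X_Cauchy \<Omega> X" and U_eq: "U = X_equiv \<Omega> X `` {\<phi>}"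
    using U(1) unfolding HX_def by (rule quotientE)
  note u = HX_fun_imp_L1_limit[OF \<phi> U(2)[unfolded U_eq] order_refl]
  have T_cont: "continuous_on UNIV T"
    using T(1) by (intro continuous_at_imp_continuous_on) (blast intro: DERIV_isCont)
  have T'_cont: "continuous_on UNIV T'" using lip by (rule lipschitz_on_continuous_on)
  have contr: "\<bar>T a - T b\<bar> \<le> \<bar>a - b\<bar>" for a b using T(1) T' by (rule contraction_of_derivative)
  have [measurable]: "u \<in> borel_measurable (lebesgue_on \<Omega>)" using u(1) by (rule borel_measurable_integrable)
  have Tu_meas [measurable]: "(\<lambda>x. T (u x)) \<in> borel_measurable (lebesgue_on \<Omega>)"
    using borel_measurable_continuous_onI[OF T_cont] by measurable
  have Tu: "integrable (lebesgue_on \<Omega>) (\<lambda>x. T (u x))"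
    using u(1) by (rule Bochner_Integration.integrable_bound) (use contr[of _ 0] T(2) in auto)
  define \<psi> where "\<psi> = (\<lambda>n x. T (\<phi> n x))"
  have \<psi>: "\<psi> \<in> X_Cauchy \<Omega> X" unfolding \<psi>_def using \<phi> u T T' lip by (rule X_Cauchy_compose)
  note C\<phi> = X_Cauchy_C1_0[OF \<phi>] and C\<psi> = X_Cauchy_C1_0[OF \<psi>]
  have int: "integrable (lebesgue_on \<Omega>) (\<phi> n)" "integrable (lebesgue_on \<Omega>) (\<psi> n)" for n
    using C\<phi> C\<psi> C1_0_integrable by auto
  define V where "V = X_equiv \<Omega> X `` {\<psi>}"
  have V: "V \<in> HX \<Omega> X" unfolding V_def HX_def using \<psi> by (rule quotientI)
  have \<psi>_lim: "(\<lambda>n. \<integral>x. \<bar>\<psi> n x - T (u x)\<bar> \<partial>lebesgue_on \<Omega>) \<longlonglongrightarrow> 0"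
  proof (rule tendsto_sandwich[OF _ _ tendsto_const u(2)])
    show "\<forall>\<^sub>F n in sequentially. (\<integral>x. \<bar>\<psi> n x - T (u x)\<bar> \<partial>lebesgue_on \<Omega>) \<le> (\<integral>x. \<bar>\<phi> n x - u x\<bar> \<partial>lebesgue_on \<Omega>)"
      using int u(1) Tu contr by (intro always_eventually allI integral_mono) (auto simp: \<psi>_def)
  qed (simp add: integral_nonneg_AE)
  \<comment> \<open>All function representatives of \<open>V\<close>, for whichever exponent, agree with the truncation
    of \<open>u\<close> almost everywhere, because they share its \<open>L\<^sup>1\<close> limit.\<close>
  have identify: "v \<in> borel_measurable (lebesgue_on \<Omega>) \<and> (AE x in lebesgue_on \<Omega>. T (u x) = v x)"
    if "HX_fun \<Omega> p V v" "p \<ge> 1" for p v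
  proof -
    note v = HX_fun_imp_L1_limit[OF \<psi> that[unfolded V_def]]
    show ?thesis
      using L1_limit_unique[OF int(2) Tu v(1) \<psi>_lim v(2)] v(1) by (auto intro: borel_measurable_integrable)
  qed
  have "HX_fun \<Omega> 1 V (\<lambda>x. T (u x))"
  proof -
    obtain v where v: "HX_fun \<Omega> 1 V v" using emb[of 1] V by (auto simp: continuous_embedding_def)
    have [measurable]: "v \<in> borel_measurable (lebesgue_on \<Omega>)" and eq: "AE x in lebesgue_on \<Omega>. T (u x) = v x"
      using identify[OF v] by auto
    have "(\<lambda>n. Lp_norm \<Omega> 1 (\<lambda>x. \<eta> n x - T (u x))) \<longlonglongrightarrow> 0" if \<eta>: "\<eta> \<in> V" for \<eta>
    proof -
      have "\<eta> \<in> X_Cauchy \<Omega> X" using \<eta> by (simp add: V_def X_equiv_def)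
      then have [measurable]: "\<eta> n \<in> borel_measurable (lebesgue_on \<Omega>)" for n
        using X_Cauchy_C1_0 C1_0_integrable by (blast intro: borel_measurable_integrable)
      have "Lp_norm \<Omega> 1 (\<lambda>x. \<eta> n x - T (u x)) = Lp_norm \<Omega> 1 (\<lambda>x. \<eta> n x - v x)" for n
        by (rule Lp_norm_cong_AE) (use eq in \<open>auto elim: eventually_mono\<close>)
      then show ?thesis using v \<eta> by (simp add: HX_fun_def)
    qed
    moreover have "(\<lambda>x. T (u x)) \<in> Lp \<Omega> 1" using Tu Tu_meas by (simp add: Lp_def)
    ultimately show ?thesis by (simp add: HX_fun_def)
  qed
  moreover have "Lp_norm \<Omega> s (\<lambda>x. T (u x)) \<le> C * HX_norm \<Omega> X V"
  proof -
    obtain v where v: "HX_fun \<Omega> s V v" using emb[of s] V by (auto simp: continuous_embedding_def)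
    have "Lp_norm \<Omega> s (\<lambda>x. T (u x)) = Lp_norm \<Omega> s v"
      using identify[OF v s] Tu_meas by (intro Lp_norm_cong_AE) auto
    with C[OF V v] show ?thesis by simp
  qed
  moreover have "(HX_norm \<Omega> X V)\<^sup>2 / \<Lambda> \<le> HX_form \<Omega> B U V"
    unfolding V_def U_eq
  proof (rule LIMSEQ_le)
    show "(\<lambda>n. (X_norm \<Omega> X (\<psi> n))\<^sup>2 / \<Lambda>) \<longlonglongrightarrow> (HX_norm \<Omega> X (X_equiv \<Omega> X `` {\<psi>}))\<^sup>2 / \<Lambda>"
      using HX_norm_limit[OF \<psi>] \<Lambda>_pos by (intro tendsto_intros) auto
    show "(\<lambda>n. energy (\<phi> n) (\<psi> n)) \<longlonglongrightarrow> HX_form \<Omega> B (X_equiv \<Omega> X `` {\<phi>}) (X_equiv \<Omega> X `` {\<psi>})"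
      by (rule HX_form_limit[OF \<phi> \<psi>])
    show "\<exists>N. \<forall>n\<ge>N. (X_norm \<Omega> X (\<psi> n))\<^sup>2 / \<Lambda> \<le> energy (\<phi> n) (\<psi> n)"
      unfolding \<psi>_def using energy_truncation_lower[OF C\<phi> T(1) T'_cont T(2) T'] by blast
  qed
  ultimately show ?thesis using V that by blast
qed

text \<open>The truncation of \<open>u\<close> between the levels \<open>k\<close> and \<open>k + 2d\<close> is inserted into the equation. Ellipticity
  and the Sobolev inequality bound \<open>d |A(k + 2d)|\<^bsup>1/s\<^esup>\<close>, with \<open>A(l)\<close> the set where \<open>|u| > l\<close>, by a
  multiple of the square root of the form, and the form is at most \<open>d\<close> times the integral of \<open>|R|\<close> over
  \<open>A(k)\<close>. The statement is the \<open>s/2\<close>-th power of the resulting inequality.\<close>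

lemma level_set_decay:
  assumes s: "s > 2" and emb: "\<And>p. p \<in> {1, s} \<Longrightarrow> continuous_embedding \<Omega> X p"
    and C: "\<And>V v. V \<in> HX \<Omega> X \<Longrightarrow> HX_fun \<Omega> s V v \<Longrightarrow> Lp_norm \<Omega> s v \<le> C * HX_norm \<Omega> X V"
    and a: "AE x in lebesgue_on \<Omega>. 0 \<le> a x" and f: "integrable (lebesgue_on \<Omega>) f"
    and f_bound: "AE x in lebesgue_on \<Omega>. \<bar>f x\<bar> \<le> Q * a x + R x"
    and r: "r > 1" and R: "R \<in> Lp \<Omega> r"
    and u: "weak_solution \<Omega> X B a f u"
    and k: "k \<ge> 0" "k \<ge> Q" and d: "d > 0"
  shows "measure (lebesgue_on \<Omega>) {x\<in>\<Omega>. \<bar>u x\<bar> > k + 2 * d}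
    \<le> (C\<^sup>2 * \<Lambda> * (1 + (\<integral>x. \<bar>R x\<bar> powr r \<partial>lebesgue_on \<Omega>)) / d) powr (s / 2)
      * measure (lebesgue_on \<Omega>) {x\<in>\<Omega>. \<bar>u x\<bar> > k} powr ((1 - 1 / r) * (s / 2))"
proof -
  interpret finite_measure "lebesgue_on \<Omega>" by (rule finite_domain)
  let ?M = "lebesgue_on \<Omega>"
  obtain U where U: "U \<in> HX \<Omega> X" "HX_fun \<Omega> 1 U u" and au: "integrable ?M (\<lambda>x. a x * u x)"
    and weak: "\<And>V v. V \<in> HX \<Omega> X \<Longrightarrow> HX_fun \<Omega> 1 V v \<Longrightarrow> v \<in> Linf \<Omega> \<Longrightarrow>
      HX_form \<Omega> B U V + (\<integral>x. a x * u x * v x \<partial>?M) = (\<integral>x. f x * v x \<partial>?M)"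
    using u unfolding weak_solution_def by blast
  have u_meas [measurable]: "u \<in> borel_measurable ?M" using U(2) by (simp add: HX_fun_def Lp_def)
  have R_meas [measurable]: "R \<in> borel_measurable ?M" and Rr: "integrable ?M (\<lambda>x. \<bar>R x\<bar> powr r)"
    using R by (auto simp: Lp_def)
  have f_meas [measurable]: "f \<in> borel_measurable ?M" using f by (rule borel_measurable_integrable)
  have au_meas [measurable]: "(\<lambda>x. a x * u x) \<in> borel_measurable ?M" using au by (rule borel_measurable_integrable)
  define A where "A l = {x\<in>\<Omega>. \<bar>u x\<bar> > l}" for l
  have A_meas [measurable]: "A l \<in> sets ?M" for l
  proof -
    have "{x\<in>space ?M. \<bar>u x\<bar> > l} \<in> sets ?M" by measurable
    then show ?thesis by (simp add: A_def)
  qed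
  obtain T T' L where T: "\<And>t. (T has_real_derivative T' t) (at t)" "T 0 = 0"
    and T': "\<And>t. 0 \<le> T' t" "\<And>t. T' t \<le> 1" "L-lipschitz_on UNIV T'"
    and T_le: "\<And>t. \<bar>T t\<bar> \<le> d" and T_0: "\<And>t. \<bar>t\<bar> \<le> k \<Longrightarrow> T t = 0"
    and T_d: "\<And>t. \<bar>t\<bar> \<ge> k + 2 * d \<Longrightarrow> \<bar>T t\<bar> = d" and T_sgn: "\<And>t. t * T t = \<bar>t\<bar> * \<bar>T t\<bar>"
    using smooth_truncation_exists[OF k(1) d] by metis
  have s1: "s \<ge> 1" using s by simp
  obtain V where V: "V \<in> HX \<Omega> X" "HX_fun \<Omega> 1 V (\<lambda>x. T (u x))"
    and V_form: "(HX_norm \<Omega> X V)\<^sup>2 / \<Lambda> \<le> HX_form \<Omega> B U V"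
    and V_norm: "Lp_norm \<Omega> s (\<lambda>x. T (u x)) \<le> C * HX_norm \<Omega> X V"
    using truncation_test_function[OF U emb s1 C T T'] by blast
  have v_meas [measurable]: "(\<lambda>x. T (u x)) \<in> borel_measurable ?M" using V(2) by (simp add: HX_fun_def Lp_def)
  have R_int: "integrable ?M R"
  proof (rule Bochner_Integration.integrable_bound)
    show "integrable ?M (\<lambda>x. 1 + 1 powr (1 - r) * \<bar>R x\<bar> powr r)" using Rr by simp
    show "AE x in ?M. norm (R x) \<le> norm (1 + 1 powr (1 - r) * \<bar>R x\<bar> powr r)"
      using truncated_power_bound[of 1 r] r by (intro AE_I2) (auto simp: add_nonneg_nonneg)
  qed simp
  have times_v: "integrable ?M (\<lambda>x. g x * T (u x))" if g: "integrable ?M g" for g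
  proof (rule Bochner_Integration.integrable_bound)
    show "integrable ?M (\<lambda>x. d * g x)" using g by simp
    show "(\<lambda>x. g x * T (u x)) \<in> borel_measurable ?M"
      using borel_measurable_integrable[OF g] by measurable
    show "AE x in ?M. norm (g x * T (u x)) \<le> norm (d * g x)"
      using mult_left_mono[OF T_le abs_ge_zero] d by (intro AE_I2) (simp add: abs_mult mult.commute)
  qed
  \<comment> \<open>Where the truncation does not vanish, \<open>|u| \<ge> k \<ge> Q\<close>, so \<open>a u T(u)\<close> absorbs the part
    \<open>Q a |T(u)|\<close> of the right-hand side and only \<open>R\<close> survives.\<close>
  have form_le: "HX_form \<Omega> B U V \<le> d * ((1 + (\<integral>x. \<bar>R x\<bar> powr r \<partial>?M)) * measure ?M (A k) powr (1 - 1 / r))"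
  proof -
    have "(\<lambda>x. T (u x)) \<in> Linf \<Omega>" using v_meas AE_I2[of ?M "\<lambda>x. \<bar>T (u x)\<bar> \<le> d", OF T_le] unfolding Linf_def by blast
    from weak[OF V this]
    have "HX_form \<Omega> B U V = (\<integral>x. f x * T (u x) - a x * u x * T (u x) \<partial>?M)"
      using times_v[OF f] times_v[OF au] by simp
    also have "\<dots> \<le> (\<integral>x. d * (\<bar>R x\<bar> * indicator (A k) x) \<partial>?M)"
    proof (rule integral_mono_AE)
      show "integrable ?M (\<lambda>x. f x * T (u x) - a x * u x * T (u x))"
        using times_v[OF f] times_v[OF au] by simp
      have "integrable ?M (\<lambda>x. \<bar>R x\<bar> * indicator (A k) x)"
        using R_int by (rule Bochner_Integration.integrable_bound) (auto simp: indicator_def)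
      then show "integrable ?M (\<lambda>x. d * (\<bar>R x\<bar> * indicator (A k) x))" by simp
      show "AE x in ?M. f x * T (u x) - a x * u x * T (u x) \<le> d * (\<bar>R x\<bar> * indicator (A k) x)"
        using a f_bound AE_space
      proof eventually_elim
        case (elim x)
        show ?case
        proof (cases "x \<in> A k")
          case False
          then have "T (u x) = 0" using elim(3) by (intro T_0) (simp add: A_def)
          with False show ?thesis by simp
        next
          case True
          then have uk: "\<bar>u x\<bar> \<ge> k" by (simp add: A_def)
          have "f x * T (u x) \<le> \<bar>f x\<bar> * \<bar>T (u x)\<bar>" by (metis abs_ge_self abs_mult)
          also have "\<dots> \<le> (a x * \<bar>u x\<bar> + \<bar>R x\<bar>) * \<bar>T (u x)\<bar>"
          proof (rule mult_right_mono)
            have "Q * a x \<le> \<bar>u x\<bar> * a x" using uk k elim(1) by (intro mult_right_mono) auto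
            then show "\<bar>f x\<bar> \<le> a x * \<bar>u x\<bar> + \<bar>R x\<bar>" using elim(2) by (simp add: mult.commute)
          qed simp
          also have "\<dots> = a x * (u x * T (u x)) + \<bar>R x\<bar> * \<bar>T (u x)\<bar>"
            unfolding T_sgn by (simp add: algebra_simps)
          also have "\<bar>R x\<bar> * \<bar>T (u x)\<bar> \<le> \<bar>R x\<bar> * d" using T_le by (intro mult_left_mono) auto
          finally show ?thesis using True by (simp add: algebra_simps)
        qed
      qed
    qed
    also have "\<dots> = d * (\<integral>x. \<bar>R x\<bar> * indicator (A k) x \<partial>?M)" by simp
    also have "\<dots> \<le> d * ((1 + (\<integral>x. \<bar>R x\<bar> powr r \<partial>?M)) * measure ?M (A k) powr (1 - 1 / r))"
      using integral_on_small_set[OF r R_meas Rr A_meas] d by (intro mult_left_mono) auto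
    finally show ?thesis .
  qed
  \<comment> \<open>Chebyshev: on the upper level set the truncation has reached the value \<open>d\<close>.\<close>
  have norm_ge: "d * measure ?M (A (k + 2 * d)) powr (1 / s) \<le> Lp_norm \<Omega> s (\<lambda>x. T (u x))"
  proof -
    have "d powr s * measure ?M (A (k + 2 * d)) = (\<integral>x. d powr s * indicator (A (k + 2 * d)) x \<partial>?M)"
      using sets.sets_into_space[OF A_meas[of "k + 2 * d"]] by (simp add: Int_absorb2)
    also have "\<dots> \<le> (\<integral>x. \<bar>T (u x)\<bar> powr s \<partial>?M)"
    proof (rule integral_mono)
      show "integrable ?M (\<lambda>x. d powr s * indicator (A (k + 2 * d)) x)"
        by (intro Bochner_Integration.integrable_mult_right integrable_real_indicator A_meas)
          (simp add: emeasure_eq_measure)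
      show "integrable ?M (\<lambda>x. \<bar>T (u x)\<bar> powr s)"
      proof (rule integrable_const_bound)
        have "\<bar>T (u x)\<bar> powr s \<le> d powr s" for x using T_le s by (intro powr_mono2) auto
        then show "AE x in ?M. norm (\<bar>T (u x)\<bar> powr s) \<le> d powr s" by simp
      qed measurable
      show "d powr s * indicator (A (k + 2 * d)) x \<le> \<bar>T (u x)\<bar> powr s" for x
        using T_d[of "u x"] by (cases "x \<in> A (k + 2 * d)") (simp_all add: A_def)
    qed
    finally have "(d powr s * measure ?M (A (k + 2 * d))) powr (1 / s) \<le> Lp_norm \<Omega> s (\<lambda>x. T (u x))"
      unfolding Lp_norm_def using s by (intro powr_mono2) auto
    then show ?thesis using d s by (simp add: powr_mult powr_powr)
  qed
  define E where "E = C\<^sup>2 * \<Lambda> * (1 + (\<integral>x. \<bar>R x\<bar> powr r \<partial>?M))"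
  define m where "m l = measure ?M (A l)" for l
  have m: "m l \<ge> 0" for l by (simp add: m_def)
  have "d\<^sup>2 * m (k + 2 * d) powr (2 / s) = (d * m (k + 2 * d) powr (1 / s))\<^sup>2"
    by (simp add: power_mult_distrib power2_eq_square flip: powr_add)
  also have "\<dots> \<le> (C * HX_norm \<Omega> X V)\<^sup>2"
    using norm_ge V_norm d unfolding m_def by (intro power_mono) auto
  also have "\<dots> = C\<^sup>2 * \<Lambda> * ((HX_norm \<Omega> X V)\<^sup>2 / \<Lambda>)" using \<Lambda>_pos by (simp add: power_mult_distrib)
  also have "\<dots> \<le> C\<^sup>2 * \<Lambda> * (d * ((1 + (\<integral>x. \<bar>R x\<bar> powr r \<partial>?M)) * m k powr (1 - 1 / r)))"
    using order_trans[OF V_form form_le] \<Lambda>_pos unfolding m_def by (intro mult_left_mono) auto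
  also have "\<dots> = d\<^sup>2 * (E / d * m k powr (1 - 1 / r))"
    using d by (simp add: E_def power2_eq_square)
  finally have "m (k + 2 * d) powr (2 / s) \<le> E / d * m k powr (1 - 1 / r)"
    using mult_le_cancel_left_pos[of "d\<^sup>2"] d by (metis zero_less_power)
  then have "(m (k + 2 * d) powr (2 / s)) powr (s / 2) \<le> (E / d * m k powr (1 - 1 / r)) powr (s / 2)"
    by (rule powr_mono2[rotated 2]) (use s in simp_all)
  moreover have "(m (k + 2 * d) powr (2 / s)) powr (s / 2) = m (k + 2 * d)"
    using s m by (simp add: powr_powr)
  moreover have "E \<ge> 0" unfolding E_def using \<Lambda>_pos by (simp add: integral_nonneg_AE)
  then have "(E / d * m k powr (1 - 1 / r)) powr (s / 2) = (E / d) powr (s / 2) * m k powr ((1 - 1 / r) * (s / 2))"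
    using d m by (subst powr_mult) (simp_all add: powr_powr)
  ultimately show ?thesis unfolding m_def A_def E_def by simp
qed

lemma weak_solution_bounded:
  assumes s: "s > 2" and emb: "\<And>p. p \<in> {1, s} \<Longrightarrow> continuous_embedding \<Omega> X p"
    and a: "AE x in lebesgue_on \<Omega>. 0 \<le> a x" and f: "integrable (lebesgue_on \<Omega>) f"
    and f_bound: "AE x in lebesgue_on \<Omega>. \<bar>f x\<bar> \<le> Q * a x + R x"
    and r: "r > s / (s - 2)" and R: "R \<in> Lp \<Omega> r"
    and u: "weak_solution \<Omega> X B a f u"
  shows "u \<in> Linf \<Omega>"
proof -
  interpret finite_measure "lebesgue_on \<Omega>" by (rule finite_domain)
  let ?M = "lebesgue_on \<Omega>"
  have "continuous_embedding \<Omega> X s" using emb by simp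
  then have "\<exists>C. \<forall>V\<in>HX \<Omega> X. \<forall>v. HX_fun \<Omega> s V v \<longrightarrow> Lp_norm \<Omega> s v \<le> C * HX_norm \<Omega> X V"
    unfolding continuous_embedding_def by (elim conjE)
  then obtain C where C: "\<And>V v. V \<in> HX \<Omega> X \<Longrightarrow> HX_fun \<Omega> s V v \<Longrightarrow> Lp_norm \<Omega> s v \<le> C * HX_norm \<Omega> X V"
    by auto
  have "s / (s - 2) > 1" using s by simp
  with r have r1: "r > 1" by simp
  have "1 / r < (s - 2) / s" using r r1 s by (simp add: field_simps)
  \<comment> \<open>This is where the integrability exponent of \<open>R\<close> enters: it makes the decay superlinear.\<close>
  then have \<beta>: "(1 - 1 / r) * (s / 2) > 1" using s r1 by (simp add: field_simps)
  have [measurable]: "u \<in> borel_measurable ?M"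
    using u by (auto simp: weak_solution_def HX_fun_def Lp_def)
  have meas [measurable]: "{x\<in>\<Omega>. \<bar>u x\<bar> > k} \<in> sets ?M" for k
  proof -
    have "{x\<in>space ?M. \<bar>u x\<bar> > k} \<in> sets ?M" by measurable
    then show ?thesis by simp
  qed
  \<comment> \<open>The factor 2 accounts for the height \<open>(h - k) / 2\<close> of the truncation between the
    levels \<open>k\<close> and \<open>h\<close>.\<close>
  define E where "E = 2 * (C\<^sup>2 * \<Lambda> * (1 + (\<integral>x. \<bar>R x\<bar> powr r \<partial>?M)))"
  have E: "E \<ge> 0" unfolding E_def using \<Lambda>_pos by (simp add: integral_nonneg_AE)
  have "\<exists>k. measure ?M {x\<in>\<Omega>. \<bar>u x\<bar> > k} = 0"
  proof (rule Stampacchia_iteration)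
    fix k h :: real
    assume k: "max 0 Q \<le> k" and h: "k < h"
    have "(h - k) / 2 > 0" "k + 2 * ((h - k) / 2) = h" using h by (simp_all add: field_simps)
    moreover have "measure ?M {x\<in>\<Omega>. \<bar>u x\<bar> > k + 2 * ((h - k) / 2)}
        \<le> (C\<^sup>2 * \<Lambda> * (1 + (\<integral>x. \<bar>R x\<bar> powr r \<partial>?M)) / ((h - k) / 2)) powr (s / 2)
          * measure ?M {x\<in>\<Omega>. \<bar>u x\<bar> > k} powr ((1 - 1 / r) * (s / 2))"
      by (rule level_set_decay[OF s _ _ a f f_bound r1 R u]) (erule emb | erule (1) C | use k h in simp)+
    moreover have "C\<^sup>2 * \<Lambda> * (1 + (\<integral>x. \<bar>R x\<bar> powr r \<partial>?M)) / ((h - k) / 2) = E / (h - k)"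
      by (simp add: E_def)
    ultimately show "measure ?M {x\<in>\<Omega>. \<bar>u x\<bar> > h}
        \<le> E powr (s / 2) / (h - k) powr (s / 2) * measure ?M {x\<in>\<Omega>. \<bar>u x\<bar> > k} powr ((1 - 1 / r) * (s / 2))"
      using E h by (simp only: powr_divide)
  next
    fix k h :: real assume "k \<le> h"
    then show "measure ?M {x\<in>\<Omega>. \<bar>u x\<bar> > h} \<le> measure ?M {x\<in>\<Omega>. \<bar>u x\<bar> > k}"
      by (intro finite_measure_mono) auto
  qed (use s \<beta> in auto)
  then obtain k where "measure ?M {x\<in>\<Omega>. \<bar>u x\<bar> > k} = 0" by blast
  then have "{x\<in>\<Omega>. \<bar>u x\<bar> > k} \<in> null_sets ?M" by (simp add: emeasure_eq_measure null_setsI)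
  then have "AE x in ?M. x \<notin> {x\<in>\<Omega>. \<bar>u x\<bar> > k}" by (rule AE_not_in)
  then have "AE x in ?M. \<bar>u x\<bar> \<le> k" using AE_space by eventually_elim (simp add: not_less)
  then show ?thesis by (auto simp: Linf_def)
qed

end

theorem proposition4p3:
  fixes \<Omega> :: "(real^'n) set"
    and X :: "'m::finite \<Rightarrow> real^'n \<Rightarrow> real^'n"
    and B :: "real^'n \<Rightarrow> real^'n^'n"
    and a f R u :: "real^'n \<Rightarrow> real"
    and s Q r \<alpha> :: real
  assumes "CARD('n) \<ge> 2"
    and "domain \<Omega>" and "bounded \<Omega>"
    and "\<And>j k. locally_lipschitz (\<lambda>x. X j x $ k)"
    and "\<And>i j. (\<lambda>x. B x $ i $ j) \<in> borel_measurable lebesgue"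
    and "\<And>x i j. B x $ i $ j = B x $ j $ i"
    and "uniformly_X_elliptic \<Omega> X B"
    and "sobolev_property \<Omega> X s"
    and "integrable (lebesgue_on \<Omega>) a"
    and "AE x in lebesgue_on \<Omega>. a x \<ge> 0"
    and "integrable (lebesgue_on \<Omega>) f"
    and "Q > 0"
    and "AE x in lebesgue_on \<Omega>. R x \<ge> 0"
    and "R \<in> Lp \<Omega> (2 * N_X s / (N_X s + 2))"
    and "AE x in lebesgue_on \<Omega>. \<bar>f x\<bar> \<le> Q * a x + R x"
    and "r > N_X s / 2" and "R \<in> Lp \<Omega> r"
    and "\<alpha> > 0" and "AE x in lebesgue_on \<Omega>. a x \<ge> \<alpha>"
    and "weak_solution \<Omega> X B a f u"
  shows "u \<in> Linf \<Omega>"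
proof -
  obtain \<Lambda> where \<Lambda>: "\<Lambda> > 0"
    and ell: "\<And>x \<xi>. x \<in> \<Omega> \<Longrightarrow> (\<Sum>j\<in>UNIV. (X j x \<bullet> \<xi>)\<^sup>2) / \<Lambda> \<le> (B x *v \<xi>) \<bullet> \<xi>
      \<and> (B x *v \<xi>) \<bullet> \<xi> \<le> \<Lambda> * (\<Sum>j\<in>UNIV. (X j x \<bullet> \<xi>)\<^sup>2)"
    using assms(7) unfolding uniformly_X_elliptic_def quadratic_form_eq[symmetric] by auto
  have "continuous_on UNIV (X j)" for j
    using continuous_on_vec_lambda[of UNIV "\<lambda>k x. X j x $ k"] locally_lipschitz_imp_continuous[OF assms(4)]
    by simp
  then interpret X_elliptic_form \<Omega> X B \<Lambda>
    using assms(2,3,5,6) \<Lambda> ell by unfold_locales (auto simp: domain_def)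
  have s: "s > 2" and emb: "\<And>p. p \<in> {1, s} \<Longrightarrow> continuous_embedding \<Omega> X p"
    using assms(8) by (auto simp: sobolev_property_def)
  have "N_X s / 2 = s / (s - 2)" unfolding N_X_def by (simp add: divide_simps)
  with assms(16) have "r > s / (s - 2)" by metis
  from weak_solution_bounded[OF s _ assms(10,11,15) this assms(17,20)] emb show ?thesis by metis
qed

end
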